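(* Let $g:[0,\infty)\to(0,\infty)$ be a continuous decreasing $\mathrm{RV}_{-1}$-function with $\int_0^\infty g(t)\,dt=\infty$. Let $(\xi_j)_{j\ge0}$ be an orthonormal basis of $\mathcal H$ and let $T$ be the positive compact operator defined by $T\xi_j=\lambda_j\xi_j$, where $$\lambda_j=2^{-m}\sum_{k=2^m-1}^{2^{m+1}-2}g(k)\qquad\text{if } 2^m-1\le j\le 2^{m+1}-2,\quad m\ge0 .$$ Then $T\in\mathcal L_g$, and $T$ is $g$-hypermeasurable in $\mathcal L_g$ with noncommutative integral $I_g(T)=1$. However, $T$ is not spectrally measurable (with respect to $g$).
   Context: $\mathcal H$ is a separable (infinite-dimensional) Hilbert space, and $\mu_0(T)\ge\mu_1(T)\ge\cdots$ are the singular values of a compact operator $T$ on $\mathcal H$. A continuous function $g:[0,\infty)\to(0,\infty)$ is $\mathrm{RV}_{-1}$ if it is ultimately monotonic and $\lim_{t\to\infty}g(\lambda t)/g(t)=\lambda^{-1}$ for all $\lambda>0$; set $G(t)=\int_0^tg(s)\,ds$. The weak Lorentz ideal is $\mathcal L_g=\{T \text{ compact}:\mu_j(T)=O(g(j))\}$. A trace on $\mathcal L_g$ is a linear functional on $\mathcal L_g$ (no continuity or positivity required) vanishing on all commutators $[A,T]$ with $A$ bounded and $T\in\mathcal L_g$. It is $g$-normalized if it takes the value $1$ on any operator $T_g$ with $T_g\eta_j=g(j)\eta_j$, $j\ge0$, for some orthonormal basis $(\eta_j)_{j\ge0}$. $T\in\mathcal L_g$ is $g$-hypermeasurable if all $g$-normalized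 traces on $\mathcal L_g$ take the same value on $T$. An extended limit is a positive linear functional $\omega$ on $\ell_\infty$ extending the limit functional on convergent sequences; the Dixmier trace is $\mathrm{Tr}_\omega(T)=\omega\bigl(\{\tfrac1{G(N)}\sum_{j<N}\lambda_j(T)\}_{N\ge1}\bigr)$, with $(\lambda_j(T))$ the eigenvalues counted with multiplicity in order of non-increasing modulus. It is a positive $g$-normalized trace. If $\mathrm{Tr}_\omega(T)$ is independent of $\omega$ (Dixmier-measurability, implied by hypermeasurability), the common value is the noncommutative integral $I_g(T)$. A selfadjoint $T\in\mathcal L_g$ is spectrally measurable if $\lim_{j\to\infty}g(j)^{-1}\lambda_j^+(T)$ and $\lim_{j\to\infty}g(j)^{-1}\lambda_j^-(T)$ both exist, where $\lambda_0^\pm(T)\ge\lambda_1^\pm(T)\ge\cdots$ are the eigenvalues of $T^\pm=\tfrac12(|T|\pm T)$ counted with multiplicity. *)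

theory Defs
  imports "HOL-Analysis.Analysis"
begin

section \<open>Complex Hilbert spaces\<close>

text \<open>
  The inner product is conjugate-linear in its first argument. The axiom \<open>cinner_self\<close> makes it
  positive definite and says that it induces the norm; completeness comes from the class
  \<^class>\<open>banach\<close>. Neither separability nor infinite dimension is part of the class: both follow from
  the existence of an orthonormal basis indexed by the natural numbers.
\<close>

class complex_hilbert = banach +
  fixes scaleC :: "complex \<Rightarrow> 'a \<Rightarrow> 'a" (infixr \<open>*\<^sub>C\<close> 75)
    and cinner :: "'a \<Rightarrow> 'a \<Rightarrow> complex"
  assumes scaleC_add_right: "c *\<^sub>C (x + y) = c *\<^sub>C x + c *\<^sub>C y"
    and scaleC_add_left: "(c + d) *\<^sub>C x = c *\<^sub>C x + d *\<^sub>C x"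
    and scaleC_scaleC: "c *\<^sub>C d *\<^sub>C x = (c * d) *\<^sub>C x"
    and scaleR_scaleC: "r *\<^sub>R x = complex_of_real r *\<^sub>C x"
    and cinner_commute: "cinner x y = cnj (cinner y x)"
    and cinner_add_right: "cinner x (y + z) = cinner x y + cinner x z"
    and cinner_scaleC_right: "cinner x (c *\<^sub>C y) = c * cinner x y"
    and cinner_self: "cinner x x = complex_of_real ((norm x)\<^sup>2)"

global_interpretation complex_vector: vector_space "scaleC :: complex \<Rightarrow> 'a \<Rightarrow> 'a::complex_hilbert"
proof
  fix c d :: complex and x y :: 'a
  show "c *\<^sub>C (x + y) = c *\<^sub>C x + c *\<^sub>C y" by (rule scaleC_add_right)
  show "(c + d) *\<^sub>C x = c *\<^sub>C x + d *\<^sub>C x" by (rule scaleC_add_left)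
  show "c *\<^sub>C d *\<^sub>C x = (c * d) *\<^sub>C x" by (rule scaleC_scaleC)
  show "1 *\<^sub>C x = x" using scaleR_scaleC[of 1 x] by simp
qed

definition orthonormal_basis :: "(nat \<Rightarrow> 'a::complex_hilbert) \<Rightarrow> bool" where
  "orthonormal_basis \<xi> \<longleftrightarrow>
     (\<forall>i j. cinner (\<xi> i) (\<xi> j) = (if i = j then 1 else 0)) \<and>
     closure (complex_vector.span (range \<xi>)) = UNIV"


section \<open>Operators\<close>

definition bounded_clinear :: "('a::complex_hilbert \<Rightarrow> 'a) \<Rightarrow> bool" where
  "bounded_clinear T \<longleftrightarrow> bounded_linear T \<and> (\<forall>c x. T (c *\<^sub>C x) = c *\<^sub>C T x)"

definition compact_operator :: "('a::complex_hilbert \<Rightarrow> 'a) \<Rightarrow> bool" where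
  "compact_operator T \<longleftrightarrow> bounded_clinear T \<and> compact (closure (T ` cball 0 1))"

definition positive_operator :: "('a::complex_hilbert \<Rightarrow> 'a) \<Rightarrow> bool" where
  "positive_operator T \<longleftrightarrow> bounded_clinear T \<and> (\<forall>x. cinner x (T x) \<in> \<real>\<^sub>\<ge>\<^sub>0)"

definition cadjoint :: "('a::complex_hilbert \<Rightarrow> 'a) \<Rightarrow> 'a \<Rightarrow> 'a" where
  "cadjoint T = (THE S. bounded_clinear S \<and> (\<forall>x y. cinner (T x) y = cinner x (S y)))"

text \<open>\<open>abs_operator T\<close> is the positive square root of \<open>T\<^sup>*T\<close>.\<close>

definition abs_operator :: "('a::complex_hilbert \<Rightarrow> 'a) \<Rightarrow> 'a \<Rightarrow> 'a" where
  "abs_operator T = (THE S. positive_operator S \<and> (\<forall>x. S (S x) = cadjoint T (T x)))"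

definition pos_part :: "('a::complex_hilbert \<Rightarrow> 'a) \<Rightarrow> 'a \<Rightarrow> 'a" where
  "pos_part T = (\<lambda>x. (1/2) *\<^sub>C (abs_operator T x + T x))"

definition neg_part :: "('a::complex_hilbert \<Rightarrow> 'a) \<Rightarrow> 'a \<Rightarrow> 'a" where
  "neg_part T = (\<lambda>x. (1/2) *\<^sub>C (abs_operator T x - T x))"


section \<open>Eigenvalues and singular values\<close>

text \<open>
  Multiplicities are algebraic, i.e. dimensions of root spaces. They are only used at nonzero
  numbers and for compact operators, where they are finite.
\<close>

definition multiplicity_at :: "('a::complex_hilbert \<Rightarrow> 'a) \<Rightarrow> complex \<Rightarrow> nat" where
  "multiplicity_at T z =
     complex_vector.dim (\<Union>n. {x. ((\<lambda>y. T y - z *\<^sub>C y) ^^ n) x = 0})"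

text \<open>
  Zero is left unconstrained: monotonicity of the modulus forces the sequence to be padded with
  zeros exactly when there are only finitely many nonzero eigenvalues. The ordering is unique up to
  permuting eigenvalues of the same modulus; \<open>eigenvalues T\<close> is some such ordering.
\<close>

definition eigenvalue_sequence :: "('a::complex_hilbert \<Rightarrow> 'a) \<Rightarrow> (nat \<Rightarrow> complex) \<Rightarrow> bool" where
  "eigenvalue_sequence T l \<longleftrightarrow>
     antimono (\<lambda>j. cmod (l j)) \<and>
     (\<forall>z. z \<noteq> 0 \<longrightarrow> finite {j. l j = z} \<and> card {j. l j = z} = multiplicity_at T z)"

definition eigenvalues :: "('a::complex_hilbert \<Rightarrow> 'a) \<Rightarrow> nat \<Rightarrow> complex" where
  "eigenvalues T = (SOME l. eigenvalue_sequence T l)"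

definition singular_value :: "('a::complex_hilbert \<Rightarrow> 'a) \<Rightarrow> nat \<Rightarrow> real" where
  "singular_value T j = Re (eigenvalues (abs_operator T) j)"


section \<open>The weak Lorentz ideal and its traces\<close>

definition RV_minus_one :: "(real \<Rightarrow> real) \<Rightarrow> bool" where
  "RV_minus_one g \<longleftrightarrow>
     continuous_on {0..} g \<and> (\<forall>t\<ge>0. g t > 0) \<and>
     (\<exists>a\<ge>0. mono_on {a..} g \<or> antimono_on {a..} g) \<and>
     (\<forall>c>0. ((\<lambda>t. g (c * t) / g t) \<longlongrightarrow> inverse c) at_top)"

definition primitive :: "(real \<Rightarrow> real) \<Rightarrow> real \<Rightarrow> real" where
  "primitive g t = integral {0..t} g"

definition weak_lorentz :: "(real \<Rightarrow> real) \<Rightarrow> ('a::complex_hilbert \<Rightarrow> 'a) set" where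
  "weak_lorentz g =
     {T. compact_operator T \<and> (\<lambda>j. singular_value T j) \<in> O(\<lambda>j. g (real j))}"

text \<open>
  A trace is represented by a function on all maps; its values outside \<^term>\<open>weak_lorentz g\<close> play no
  role.
\<close>

definition trace_on :: "(real \<Rightarrow> real) \<Rightarrow> (('a::complex_hilbert \<Rightarrow> 'a) \<Rightarrow> complex) \<Rightarrow> bool" where
  "trace_on g \<phi> \<longleftrightarrow>
     (\<forall>S\<in>weak_lorentz g. \<forall>T\<in>weak_lorentz g. \<phi> (\<lambda>x. S x + T x) = \<phi> S + \<phi> T) \<and>
     (\<forall>c. \<forall>T\<in>weak_lorentz g. \<phi> (\<lambda>x. c *\<^sub>C T x) = c * \<phi> T) \<and>
     (\<forall>A. bounded_clinear A \<longrightarrow> (\<forall>T\<in>weak_lorentz g. \<phi> (\<lambda>x. A (T x) - T (A x)) = 0))"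

definition normalized_trace_on ::
    "(real \<Rightarrow> real) \<Rightarrow> (('a::complex_hilbert \<Rightarrow> 'a) \<Rightarrow> complex) \<Rightarrow> bool" where
  "normalized_trace_on g \<phi> \<longleftrightarrow>
     trace_on g \<phi> \<and>
     (\<forall>\<eta> T. orthonormal_basis \<eta> \<and> bounded_clinear T \<and>
        (\<forall>j. T (\<eta> j) = complex_of_real (g (real j)) *\<^sub>C \<eta> j) \<longrightarrow> \<phi> T = 1)"

definition hypermeasurable :: "(real \<Rightarrow> real) \<Rightarrow> ('a::complex_hilbert \<Rightarrow> 'a) \<Rightarrow> bool" where
  "hypermeasurable g T \<longleftrightarrow>
     T \<in> weak_lorentz g \<and> (\<exists>c. \<forall>\<phi>. normalized_trace_on g \<phi> \<longrightarrow> \<phi> T = c)"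


section \<open>Dixmier traces and the noncommutative integral\<close>

text \<open>As for traces, values of \<open>\<omega>\<close> on unbounded sequences play no role.\<close>

definition extended_limit :: "((nat \<Rightarrow> complex) \<Rightarrow> complex) \<Rightarrow> bool" where
  "extended_limit \<omega> \<longleftrightarrow>
     (\<forall>a b. Bseq a \<and> Bseq b \<longrightarrow> \<omega> (\<lambda>n. a n + b n) = \<omega> a + \<omega> b) \<and>
     (\<forall>c a. Bseq a \<longrightarrow> \<omega> (\<lambda>n. c * a n) = c * \<omega> a) \<and>
     (\<forall>a. Bseq a \<and> (\<forall>n. a n \<in> \<real>\<^sub>\<ge>\<^sub>0) \<longrightarrow> \<omega> a \<in> \<real>\<^sub>\<ge>\<^sub>0) \<and>
     (\<forall>a l. a \<longlonglongrightarrow> l \<longrightarrow> \<omega> a = l)"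

text \<open>The index \<open>n\<close> stands for \<open>N = n + 1\<close>, so that \<open>N\<close> runs through the positive integers.\<close>

definition dixmier_trace ::
    "(real \<Rightarrow> real) \<Rightarrow> ((nat \<Rightarrow> complex) \<Rightarrow> complex) \<Rightarrow> ('a::complex_hilbert \<Rightarrow> 'a) \<Rightarrow> complex" where
  "dixmier_trace g \<omega> T =
     \<omega> (\<lambda>n. (\<Sum>j<Suc n. eigenvalues T j) / complex_of_real (primitive g (real (Suc n))))"

definition dixmier_measurable :: "(real \<Rightarrow> real) \<Rightarrow> ('a::complex_hilbert \<Rightarrow> 'a) \<Rightarrow> bool" where
  "dixmier_measurable g T \<longleftrightarrow>
     T \<in> weak_lorentz g \<and> (\<exists>c. \<forall>\<omega>. extended_limit \<omega> \<longrightarrow> dixmier_trace g \<omega> T = c)"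

definition nc_integral :: "(real \<Rightarrow> real) \<Rightarrow> ('a::complex_hilbert \<Rightarrow> 'a) \<Rightarrow> complex" where
  "nc_integral g T = (THE c. \<forall>\<omega>. extended_limit \<omega> \<longrightarrow> dixmier_trace g \<omega> T = c)"


section \<open>Spectral measurability\<close>

text \<open>
  To be applied to selfadjoint elements of \<^term>\<open>weak_lorentz g\<close>. These conditions are deliberately
  not included, so that the negation says precisely that one of the two limits does not exist. The
  eigenvalues of the positive operators involved are real, and \<^const>\<open>Re\<close> is only a coercion.
\<close>

definition spectrally_measurable :: "(real \<Rightarrow> real) \<Rightarrow> ('a::complex_hilbert \<Rightarrow> 'a) \<Rightarrow> bool" where
  "spectrally_measurable g T \<longleftrightarrow>
     convergent (\<lambda>j. inverse (g (real j)) * Re (eigenvalues (pos_part T) j)) \<and>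
     convergent (\<lambda>j. inverse (g (real j)) * Re (eigenvalues (neg_part T) j))"

end

theory Submission
  imports Defs "HOL-Library.Discrete_Functions"
begin

text \<open>
  The operator \<open>T\<close> arises from the model operator \<open>T\<^sub>g\<close>, with eigenvalues \<open>g(j)\<close> on the same basis, by
  averaging the eigenvalues over the dyadic blocks \<open>2\<^sup>m - 1 \<le> j \<le> 2\<^sup>m\<^sup>+\<^sup>1 - 2\<close>.

  A trace does not see the averaging. The difference \<open>D = T - T\<^sub>g\<close> is diagonal, its entries have sum
  zero on every block, and on the \<open>m\<close>-th block they are bounded by \<open>g(2\<^sup>m - 1)\<close>, which by regular
  variation is comparable with \<open>g(j)\<close> for every \<open>j\<close> in the block. Real numbers of modulus at most
  \<open>M\<close> with sum zero can be ordered in such a way that all partial sums stay within \<open>[- M, M]\<close>.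
  Permuting the basis inside the blocks accordingly (\<open>blockwise_rearrangement\<close>), the partial sums \<open>s\<^sub>n\<close>
  of the entries of \<open>D\<close> are \<open>O(g(n))\<close>. Then \<open>D\<close> is the commutator of the backward shift and the
  forward shift with weights \<open>s\<^sub>n\<close>, and the latter belongs to the ideal
  (\<open>trace_diagonal_eq_zero\<close>). A normalized trace therefore takes the same value, \<open>1\<close>, on \<open>T\<close> and \<open>T\<^sub>g\<close>.

  All operators in this argument have the form \<open>x \<mapsto> \<Sum>\<^sub>j a\<^sub>j \<langle>u\<^sub>j, x\<rangle> v\<^sub>j\<close> with orthonormal \<open>u\<close> and \<open>v\<close>. If
  \<open>u\<close> is a basis, the absolute value is the diagonal operator with entries \<open>\<bar>a\<^sub>j\<bar>\<close>, and counting
  eigenvalues shows that \<open>a\<^sub>j = O(g(j))\<close> implies membership in the ideal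
  (\<open>transfer_operator_in_weak_lorentz\<close>), whether or not the \<open>\<bar>a\<^sub>j\<bar>\<close> are sorted.

  For the Dixmier traces, partial sums of averaged and original eigenvalues differ by at most
  \<open>2\<^sup>m g(2\<^sup>m - 1)\<close>, the contribution of one block. As \<open>t g(t)\<close> varies slowly, this is of smaller order than
  the sum of \<open>g\<close> over all preceding blocks (\<open>block_start_negligible\<close>). Partial sums of \<open>g\<close> are in turn
  asymptotic to its integral, since the latter diverges. So the sequence under the extended limit converges to \<open>1\<close>.

  Averaging is nevertheless visible to the individual eigenvalues: across a block \<open>g\<close> drops by a factor
  which tends to \<open>2\<close>, while the eigenvalue of \<open>T\<close> stays constant, so that their ratio cannot converge.
\<close>

section \<open>Inner products and orthonormal sequences\<close>

lemma mult_cnj_eq: "z * cnj z = (complex_of_real (cmod z))\<^sup>2" "cnj z * z = (complex_of_real (cmod z))\<^sup>2"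
  using complex_norm_square[of z] by (simp_all add: mult.commute)

lemma cinner_add_left: "cinner (x + y) z = cinner x z + cinner y z"
  for x :: "'a::complex_hilbert"
  by (metis cinner_commute cinner_add_right complex_cnj_add)

lemma cinner_scaleC_left: "cinner (c *\<^sub>C x) y = cnj c * cinner x y"
  for x :: "'a::complex_hilbert"
  by (metis cinner_commute cinner_scaleC_right complex_cnj_mult)

lemma cinner_zero_right [simp]: "cinner x 0 = 0" for x :: "'a::complex_hilbert"
  using cinner_add_right[of x 0 0] by simp

lemma cinner_zero_left [simp]: "cinner 0 x = 0" for x :: "'a::complex_hilbert"
  using cinner_add_left[of 0 0 x] by simp

lemma cinner_diff_right: "cinner x (y - z) = cinner x y - cinner x z" for x :: "'a::complex_hilbert"
  using cinner_add_right[of x "y - z" z] by simp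

lemma cinner_diff_left: "cinner (x - y) z = cinner x z - cinner y z" for x :: "'a::complex_hilbert"
  using cinner_add_left[of "x - y" y z] by simp

lemma cinner_sum_right: "cinner x (sum f A) = (\<Sum>i\<in>A. cinner x (f i))" for x :: "'a::complex_hilbert"
  by (induction A rule: infinite_finite_induct) (auto simp: cinner_add_right)

lemma cinner_sum_left: "cinner (sum f A) x = (\<Sum>i\<in>A. cinner (f i) x)" for x :: "'a::complex_hilbert"
  by (induction A rule: infinite_finite_induct) (auto simp: cinner_add_left)

lemma norm_scaleC [simp]: "norm (c *\<^sub>C x) = cmod c * norm x" for x :: "'a::complex_hilbert"
proof -
  have "complex_of_real ((norm (c *\<^sub>C x))\<^sup>2) = cinner (c *\<^sub>C x) (c *\<^sub>C x)"
    by (simp only: cinner_self)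
  also have "\<dots> = (c * cnj c) * cinner x x"
    by (simp add: cinner_scaleC_left cinner_scaleC_right)
  also have "\<dots> = complex_of_real ((cmod c * norm x)\<^sup>2)"
    by (simp add: cinner_self mult_cnj_eq power_mult_distrib)
  finally have "(norm (c *\<^sub>C x))\<^sup>2 = (cmod c * norm x)\<^sup>2"
    by (simp only: of_real_eq_iff)
  thus ?thesis by (simp add: power2_eq_iff_nonneg)
qed

text \<open>
  Expanding the square norm of \<open>\<parallel>x\<parallel>\<^sup>2 y - \<langle>x, y\<rangle> x\<close>, a multiple of the part of \<open>y\<close> orthogonal
  to \<open>x\<close>, gives \<open>\<parallel>x\<parallel>\<^sup>2 (\<parallel>x\<parallel>\<^sup>2 \<parallel>y\<parallel>\<^sup>2 - \<bar>\<langle>x, y\<rangle>\<bar>\<^sup>2) \<ge> 0\<close>.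
\<close>

lemma Cauchy_Schwarz_cinner: "cmod (cinner x y) \<le> norm x * norm y" for x :: "'a::complex_hilbert"
proof (cases "x = 0")
  case False
  define z where "z = cinner x y"
  define n where "n = (norm x)\<^sup>2"
  have n: "n > 0" using False by (simp add: n_def)
  define w where "w = complex_of_real n *\<^sub>C y - z *\<^sub>C x"
  have yx: "cinner y x = cnj z" unfolding z_def by (rule cinner_commute)
  have "complex_of_real ((norm w)\<^sup>2) = cinner w w" by (simp only: cinner_self)
  also have "\<dots> = of_real n * (of_real n * cinner y y - z * cnj z)"
    by (simp add: w_def cinner_diff_left cinner_diff_right cinner_scaleC_left cinner_scaleC_right
        yx flip: z_def) (simp add: cinner_self n_def algebra_simps)
  also have "\<dots> = complex_of_real (n * (n * (norm y)\<^sup>2 - (cmod z)\<^sup>2))"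
    by (simp add: cinner_self mult_cnj_eq)
  finally have "(norm w)\<^sup>2 = n * (n * (norm y)\<^sup>2 - (cmod z)\<^sup>2)"
    by (simp only: of_real_eq_iff)
  hence "n * (norm y)\<^sup>2 - (cmod z)\<^sup>2 \<ge> 0"
    using n by (metis zero_le_mult_iff zero_le_power2 less_le_not_le)
  hence "(cmod z)\<^sup>2 \<le> (norm x * norm y)\<^sup>2" by (simp add: n_def power_mult_distrib)
  thus ?thesis unfolding z_def using power2_le_imp_le by fastforce
qed auto

lemma bounded_linear_cinner_right: "bounded_linear (cinner x)" for x :: "'a::complex_hilbert"
proof (rule bounded_linear_intro[where K = "norm x"])
  fix r y show "cinner x (r *\<^sub>R y) = r *\<^sub>R cinner x y"
    by (simp add: scaleR_scaleC cinner_scaleC_right scaleR_conv_of_real)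
  fix y show "norm (cinner x y) \<le> norm y * norm x"
    using Cauchy_Schwarz_cinner[of x y] by (simp add: mult.commute)
qed (rule cinner_add_right)

lemma bounded_linear_cinner_left: "bounded_linear (\<lambda>y. cinner y x)" for x :: "'a::complex_hilbert"
proof (rule bounded_linear_intro[where K = "norm x"])
  fix r y show "cinner (r *\<^sub>R y) x = r *\<^sub>R cinner y x"
    by (simp add: scaleR_scaleC cinner_scaleC_left scaleR_conv_of_real)
  fix y show "norm (cinner y x) \<le> norm y * norm x"
    using Cauchy_Schwarz_cinner[of y x] by simp
qed (rule cinner_add_left)

lemma bounded_linear_scaleC: "bounded_linear (scaleC c :: 'a::complex_hilbert \<Rightarrow> 'a)"
proof (rule bounded_linear_intro[where K = "cmod c"])
  fix r and x :: 'a show "c *\<^sub>C r *\<^sub>R x = r *\<^sub>R c *\<^sub>C x"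
    by (simp add: scaleR_scaleC scaleC_scaleC mult.commute)
qed (auto simp: scaleC_add_right mult.commute)

lemma bounded_linear_scaleC_left: "bounded_linear (\<lambda>c. c *\<^sub>C x)" for x :: "'a::complex_hilbert"
proof (rule bounded_linear_intro[where K = "norm x"])
  fix r and c show "(r *\<^sub>R c) *\<^sub>C x = r *\<^sub>R c *\<^sub>C x"
    by (simp add: scaleR_scaleC scaleC_scaleC scaleR_conv_of_real)
qed (auto simp: scaleC_add_left)

lemmas bounded_clinearD = bounded_clinear_def[THEN iffD1, THEN conjunct1]

lemma bounded_clinear_scaleC: "bounded_clinear T \<Longrightarrow> T (c *\<^sub>C x) = c *\<^sub>C T x"
  by (simp add: bounded_clinear_def)

lemma bounded_clinear_compose:
  "bounded_clinear S \<Longrightarrow> bounded_clinear T \<Longrightarrow> bounded_clinear (\<lambda>x. S (T x))"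
  by (auto simp: bounded_clinear_def intro: bounded_linear_compose)

lemma bounded_clinear_add:
  "bounded_clinear S \<Longrightarrow> bounded_clinear T \<Longrightarrow> bounded_clinear (\<lambda>x. S x + T x)"
  by (auto simp: bounded_clinear_def scaleC_add_right intro: bounded_linear_add)

lemma bounded_clinear_diff:
  "bounded_clinear S \<Longrightarrow> bounded_clinear T \<Longrightarrow> bounded_clinear (\<lambda>x. S x - T x)"
  by (auto simp: bounded_clinear_def complex_vector.scale_right_diff_distrib intro: bounded_linear_sub)

definition orthonormal :: "(nat \<Rightarrow> 'a::complex_hilbert) \<Rightarrow> bool" where
  "orthonormal u \<longleftrightarrow> (\<forall>i j. cinner (u i) (u j) = (if i = j then 1 else 0))"

lemma orthonormalD: "orthonormal u \<Longrightarrow> cinner (u i) (u j) = (if i = j then 1 else 0)"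
  by (simp add: orthonormal_def)

lemma orthonormal_basis_imp_orthonormal: "orthonormal_basis u \<Longrightarrow> orthonormal u"
  by (simp add: orthonormal_basis_def orthonormal_def)

lemma orthonormal_reindex: "orthonormal u \<Longrightarrow> inj p \<Longrightarrow> orthonormal (\<lambda>n. u (p n))"
  by (auto simp: orthonormal_def inj_eq)

lemma orthonormal_basis_reindex:
  assumes "orthonormal_basis u" and "bij p"
  shows "orthonormal_basis (\<lambda>n. u (p n))"
proof -
  have "range (\<lambda>n. u (p n)) = range u"
    using bij_is_surj[OF assms(2)] by (metis image_image)
  thus ?thesis
    using assms by (auto simp: orthonormal_basis_def bij_def inj_eq)
qed

text \<open>
  The function \<open>h\<close> prescribes how the two maps transform scalars. It makes the lemma apply both to
  linear operators and to the conjugate-linear functionals \<open>\<lambda>y. cinner y x\<close>. The set where the maps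
  agree is a closed subspace, hence contains the closed span of the basis.
\<close>

lemma clinear_eq_on_basis:
  assumes u: "orthonormal_basis u"
    and f: "bounded_linear f" "\<And>c x. f (c *\<^sub>C x) = h c (f x)"
    and g: "bounded_linear g" "\<And>c x. g (c *\<^sub>C x) = h c (g x)"
    and eq: "\<And>j. f (u j) = g (u j)"
  shows "f = g"
proof
  fix x
  interpret f: bounded_linear f by fact
  interpret g: bounded_linear g by fact
  have "range u \<subseteq> {x. f x = g x}" using eq by auto
  moreover have "complex_vector.subspace {x. f x = g x}"
    by (rule complex_vector.subspaceI) (auto simp: f.zero g.zero f.add g.add f(2) g(2))
  ultimately have "complex_vector.span (range u) \<subseteq> {x. f x = g x}"
    by (rule complex_vector.span_minimal)
  moreover have "closed {x. f x = g x}"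
    by (intro closed_Collect_eq f.continuous_on g.continuous_on continuous_on_id)
  ultimately have "closure (complex_vector.span (range u)) \<subseteq> {x. f x = g x}"
    by (rule closure_minimal)
  thus "f x = g x" using u by (auto simp: orthonormal_basis_def)
qed

lemma bounded_clinear_eq_on_basis:
  assumes "orthonormal_basis u" "bounded_clinear S" "bounded_clinear T"
    and "\<And>j. S (u j) = T (u j)"
  shows "S = T"
  using assms by (intro clinear_eq_on_basis[where h = scaleC]) (auto simp: bounded_clinear_def)

lemma orthonormal_basis_total:
  assumes "orthonormal_basis u" "\<And>j. cinner (u j) x = 0"
  shows "x = 0"
proof -
  have "(\<lambda>y. cinner y x) = (\<lambda>y. 0)"
    using assms
    by (intro clinear_eq_on_basis[where h = "\<lambda>c z. cnj c * z" and u = u])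
       (auto simp: cinner_scaleC_left bounded_linear_cinner_left)
  hence "cinner x x = 0" by metis
  thus ?thesis by (simp add: cinner_self)
qed

lemma orthonormal_basis_eqI:
  assumes "orthonormal_basis u" "\<And>j. cinner (u j) x = cinner (u j) y"
  shows "x = y"
  using orthonormal_basis_total[of u "x - y"] assms by (simp add: cinner_diff_right)

lemma norm_sum_orthonormal:
  assumes "orthonormal u" "finite A"
  shows "(norm (\<Sum>j\<in>A. c j *\<^sub>C u j))\<^sup>2 = (\<Sum>j\<in>A. (cmod (c j))\<^sup>2)"
proof -
  have "complex_of_real ((norm (\<Sum>j\<in>A. c j *\<^sub>C u j))\<^sup>2)
      = (\<Sum>i\<in>A. \<Sum>j\<in>A. cnj (c i) * (c j * cinner (u i) (u j)))"
    unfolding cinner_self[symmetric]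
    by (subst cinner_sum_left, simp add: cinner_sum_right cinner_scaleC_left cinner_scaleC_right
        sum_distrib_left mult_ac)
  also have "\<dots> = (\<Sum>i\<in>A. \<Sum>j\<in>A. if i = j then cnj (c i) * c i else 0)"
    by (intro sum.cong refl) (auto simp: orthonormalD[OF assms(1)])
  also have "\<dots> = (\<Sum>i\<in>A. cnj (c i) * c i)"
    using assms(2) by (simp add: sum.delta)
  also have "\<dots> = complex_of_real (\<Sum>j\<in>A. (cmod (c j))\<^sup>2)"
    by (simp add: mult_cnj_eq)
  finally show ?thesis by (simp only: of_real_eq_iff)
qed

lemma Bessel_inequality_finite:
  assumes "orthonormal u" "finite A"
  shows "(\<Sum>j\<in>A. (cmod (cinner (u j) x))\<^sup>2) \<le> (norm x)\<^sup>2"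
proof -
  define p where "p = (\<Sum>j\<in>A. cinner (u j) x *\<^sub>C u j)"
  define s where "s = (\<Sum>j\<in>A. (cmod (cinner (u j) x))\<^sup>2)"
  have p: "(norm p)\<^sup>2 = s" unfolding p_def s_def by (rule norm_sum_orthonormal[OF assms])
  have px: "cinner p x = complex_of_real s"
    by (simp add: p_def s_def cinner_sum_left cinner_scaleC_left mult_cnj_eq)
  have xp: "cinner x p = complex_of_real s"
    by (subst cinner_commute) (simp add: px)
  have "complex_of_real ((norm (x - p))\<^sup>2) = cinner (x - p) (x - p)" by (simp only: cinner_self)
  also have "\<dots> = complex_of_real ((norm x)\<^sup>2 - s)"
    by (simp add: cinner_diff_left cinner_diff_right px xp)
       (simp add: cinner_self flip: p)
  finally have "(norm (x - p))\<^sup>2 = (norm x)\<^sup>2 - s" by (simp only: of_real_eq_iff)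
  thus ?thesis unfolding s_def using zero_le_power2[of "norm (x - p)"] by linarith
qed

lemma Bessel_inequality:
  assumes "orthonormal u"
  shows "summable (\<lambda>j. (cmod (cinner (u j) x))\<^sup>2)" "(\<Sum>j. (cmod (cinner (u j) x))\<^sup>2) \<le> (norm x)\<^sup>2"
proof -
  show "summable (\<lambda>j. (cmod (cinner (u j) x))\<^sup>2)"
    by (rule bounded_imp_summable[where B = "(norm x)\<^sup>2"])
       (use Bessel_inequality_finite[OF assms] in auto)
  thus "(\<Sum>j. (cmod (cinner (u j) x))\<^sup>2) \<le> (norm x)\<^sup>2"
    by (rule suminf_le_const) (use Bessel_inequality_finite[OF assms] in auto)
qed

text \<open>
  Square summability of the coefficients makes the partial sums a Cauchy sequence, by Pythagoras;
  this is where completeness of the space enters.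
\<close>

lemma Riesz_Fischer:
  assumes "orthonormal u" and s: "summable (\<lambda>j. (cmod (c j))\<^sup>2)"
  shows "summable (\<lambda>j. c j *\<^sub>C u j)"
    and "(norm (\<Sum>j. c j *\<^sub>C u j))\<^sup>2 = (\<Sum>j. (cmod (c j))\<^sup>2)"
proof -
  show sm: "summable (\<lambda>j. c j *\<^sub>C u j)"
    unfolding summable_Cauchy
  proof (intro allI impI)
    fix e :: real assume e: "e > 0"
    hence "e\<^sup>2 > 0" by simp
    then obtain N where N: "\<And>m n. m \<ge> N \<Longrightarrow> norm (\<Sum>j=m..<n. (cmod (c j))\<^sup>2) < e\<^sup>2"
      using s unfolding summable_Cauchy by meson
    have "norm (\<Sum>j=m..<n. c j *\<^sub>C u j) < e" if "m \<ge> N" for m n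
    proof -
      have "(norm (\<Sum>j=m..<n. c j *\<^sub>C u j))\<^sup>2 < e\<^sup>2"
        using N[OF that, of n] by (simp add: norm_sum_orthonormal[OF assms(1)])
      thus ?thesis using e power2_less_imp_less by fastforce
    qed
    thus "\<exists>N. \<forall>m\<ge>N. \<forall>n. norm (\<Sum>j=m..<n. c j *\<^sub>C u j) < e" by blast
  qed
  have "(\<lambda>n. (norm (\<Sum>j<n. c j *\<^sub>C u j))\<^sup>2) \<longlonglongrightarrow> (norm (\<Sum>j. c j *\<^sub>C u j))\<^sup>2"
    by (intro tendsto_power tendsto_norm summable_LIMSEQ sm)
  moreover have "(\<lambda>n. (norm (\<Sum>j<n. c j *\<^sub>C u j))\<^sup>2) \<longlonglongrightarrow> (\<Sum>j. (cmod (c j))\<^sup>2)"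
    using summable_LIMSEQ[OF s] by (simp add: norm_sum_orthonormal[OF assms(1)])
  ultimately show "(norm (\<Sum>j. c j *\<^sub>C u j))\<^sup>2 = (\<Sum>j. (cmod (c j))\<^sup>2)"
    by (rule LIMSEQ_unique)
qed

section \<open>Operators mapping one orthonormal sequence to another\<close>

text \<open>
  The operator \<open>\<Sum>\<^sub>j a\<^sub>j \<langle>u\<^sub>j, \<cdot>\<rangle> v\<^sub>j\<close>. With \<open>u = v\<close> it is a diagonal operator, and with \<open>v\<close> or \<open>u\<close> a
  translate of the other it is a weighted forward or backward shift; no other operators occur below.
\<close>

definition transfer_operator ::
    "(nat \<Rightarrow> 'a::complex_hilbert) \<Rightarrow> (nat \<Rightarrow> 'a) \<Rightarrow> (nat \<Rightarrow> complex) \<Rightarrow> 'a \<Rightarrow> 'a" where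
  "transfer_operator u v a x = (\<Sum>j. (a j * cinner (u j) x) *\<^sub>C v j)"

lemma transfer_operator_orthogonal:
  assumes "\<And>j. cinner (u j) x = 0" shows "transfer_operator u v a x = 0"
  by (simp add: transfer_operator_def assms)

context
  fixes u v :: "nat \<Rightarrow> 'a::complex_hilbert" and a :: "nat \<Rightarrow> complex" and M :: real
  assumes u: "orthonormal u" and v: "orthonormal v" and aM: "\<And>j. cmod (a j) \<le> M"
begin

lemma weight_bound_nonneg: "M \<ge> 0"
  using aM[of 0] norm_ge_zero order_trans by blast

lemma transfer_coeff_le: "(cmod (a j * cinner (u j) x))\<^sup>2 \<le> M\<^sup>2 * (cmod (cinner (u j) x))\<^sup>2"
  by (simp add: norm_mult power_mult_distrib mult_right_mono power_mono aM)

lemma transfer_coeff_summable: "summable (\<lambda>j. (cmod (a j * cinner (u j) x))\<^sup>2)"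
  by (rule summable_comparison_test'[where g = "\<lambda>j. M\<^sup>2 * (cmod (cinner (u j) x))\<^sup>2" and N = 0])
     (use transfer_coeff_le in \<open>auto intro: summable_mult Bessel_inequality[OF u]\<close>)

lemma transfer_operator_sums:
  "(\<lambda>j. (a j * cinner (u j) x) *\<^sub>C v j) sums transfer_operator u v a x"
  unfolding transfer_operator_def
  by (rule summable_sums, rule Riesz_Fischer[OF v transfer_coeff_summable])

lemma norm_transfer_operator_le: "norm (transfer_operator u v a x) \<le> M * norm x"
proof -
  have "(norm (transfer_operator u v a x))\<^sup>2 = (\<Sum>j. (cmod (a j * cinner (u j) x))\<^sup>2)"
    unfolding transfer_operator_def by (rule Riesz_Fischer[OF v transfer_coeff_summable])
  also have "\<dots> \<le> (\<Sum>j. M\<^sup>2 * (cmod (cinner (u j) x))\<^sup>2)"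
    by (intro suminf_le transfer_coeff_le transfer_coeff_summable summable_mult Bessel_inequality[OF u])
  also have "\<dots> = M\<^sup>2 * (\<Sum>j. (cmod (cinner (u j) x))\<^sup>2)"
    by (rule suminf_mult) (rule Bessel_inequality[OF u])
  also have "\<dots> \<le> M\<^sup>2 * (norm x)\<^sup>2"
    by (intro mult_left_mono Bessel_inequality[OF u]) auto
  finally have "(norm (transfer_operator u v a x))\<^sup>2 \<le> (M * norm x)\<^sup>2"
    by (simp add: power_mult_distrib)
  thus ?thesis by (rule power2_le_imp_le) (simp add: weight_bound_nonneg)
qed

lemma transfer_operator_scaleC:
  "transfer_operator u v a (c *\<^sub>C x) = c *\<^sub>C transfer_operator u v a x"
proof (rule sums_unique2[OF transfer_operator_sums])
  show "(\<lambda>j. (a j * cinner (u j) (c *\<^sub>C x)) *\<^sub>C v j) sums (c *\<^sub>C transfer_operator u v a x)"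
    using bounded_linear.sums[OF bounded_linear_scaleC[of c] transfer_operator_sums[of x]]
    by (simp add: scaleC_scaleC cinner_scaleC_right mult.left_commute)
qed

lemma transfer_operator_add:
  "transfer_operator u v a (x + y) = transfer_operator u v a x + transfer_operator u v a y"
proof (rule sums_unique2[OF transfer_operator_sums])
  show "(\<lambda>j. (a j * cinner (u j) (x + y)) *\<^sub>C v j) sums
          (transfer_operator u v a x + transfer_operator u v a y)"
    using sums_add[OF transfer_operator_sums[of x] transfer_operator_sums[of y]]
    by (simp add: cinner_add_right scaleC_add_left distrib_left)
qed

lemma bounded_clinear_transfer_operator: "bounded_clinear (transfer_operator u v a)"
  unfolding bounded_clinear_def
proof (intro conjI allI)
  show "bounded_linear (transfer_operator u v a)"
    by (rule bounded_linear_intro[where K = M])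
       (auto simp: transfer_operator_add transfer_operator_scaleC scaleR_scaleC
         norm_transfer_operator_le mult.commute)
qed (rule transfer_operator_scaleC)

lemma transfer_operator_apply: "transfer_operator u v a (u j) = a j *\<^sub>C v j"
proof (rule sums_unique2[OF transfer_operator_sums])
  show "(\<lambda>i. (a i * cinner (u i) (u j)) *\<^sub>C v i) sums (a j *\<^sub>C v j)"
    using sums_single[of j "\<lambda>i. a i *\<^sub>C v i"]
    by (rule back_subst[of "\<lambda>f. f sums _"]) (auto simp: orthonormalD[OF u] fun_eq_iff)
qed

lemma cinner_transfer_operator_sums:
  "(\<lambda>j. a j * cinner (u j) x * cinner y (v j)) sums cinner y (transfer_operator u v a x)"
  using bounded_linear.sums[OF bounded_linear_cinner_right[of y] transfer_operator_sums[of x]]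
  by (simp add: cinner_scaleC_right)

lemma cinner_transfer_operator: "cinner (v j) (transfer_operator u v a x) = a j * cinner (u j) x"
proof (rule sums_unique2[OF cinner_transfer_operator_sums])
  show "(\<lambda>i. a i * cinner (u i) x * cinner (v j) (v i)) sums (a j * cinner (u j) x)"
    using sums_single[of j "\<lambda>i. a i * cinner (u i) x"]
    by (rule back_subst[of "\<lambda>f. f sums _"]) (auto simp: orthonormalD[OF v] fun_eq_iff)
qed

end

lemma transfer_operator_adjoint:
  assumes u: "orthonormal u" and v: "orthonormal v" and aM: "\<And>j. cmod (a j) \<le> M"
  shows "cinner (transfer_operator u v a x) y = cinner x (transfer_operator v u (\<lambda>j. cnj (a j)) y)"
proof (rule sums_unique2)
  have "(\<lambda>j. cnj (a j * cinner (u j) x * cinner y (v j))) sums cnj (cinner y (transfer_operator u v a x))"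
    unfolding sums_cnj by (rule cinner_transfer_operator_sums[OF assms])
  thus "(\<lambda>j. cnj (a j) * cinner (v j) y * cinner x (u j)) sums cinner (transfer_operator u v a x) y"
    by (simp add: mult_ac flip: cinner_commute)
  show "(\<lambda>j. cnj (a j) * cinner (v j) y * cinner x (u j)) sums
          cinner x (transfer_operator v u (\<lambda>j. cnj (a j)) y)"
    by (rule cinner_transfer_operator_sums[OF v u, of _ M]) (simp add: aM)
qed

lemma positive_transfer_operator:
  assumes u: "orthonormal u" and aM: "\<And>j. cmod (a j) \<le> M" and a: "\<And>j. a j \<in> \<real>\<^sub>\<ge>\<^sub>0"
  shows "positive_operator (transfer_operator u u a)"
  unfolding positive_operator_def
proof (intro conjI allI)
  show "bounded_clinear (transfer_operator u u a)"
    by (rule bounded_clinear_transfer_operator[OF u u aM])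
  fix x
  have "(\<lambda>j. a j * cinner (u j) x * cinner x (u j)) sums cinner x (transfer_operator u u a x)"
    by (rule cinner_transfer_operator_sums[OF u u aM])
  moreover have "a j * cinner (u j) x * cinner x (u j) \<in> \<real>\<^sub>\<ge>\<^sub>0" for j
  proof -
    have "cinner (u j) x * cinner x (u j) = complex_of_real ((cmod (cinner (u j) x))\<^sup>2)"
      by (subst (2) cinner_commute) (simp add: mult_cnj_eq)
    hence "cinner (u j) x * cinner x (u j) \<in> \<real>\<^sub>\<ge>\<^sub>0" by (simp del: of_real_power)
    from nonneg_Reals_mult_I[OF a this, of j] show ?thesis by (simp add: mult.assoc)
  qed
  hence "(\<Sum>j<n. a j * cinner (u j) x * cinner x (u j)) \<in> \<real>\<^sub>\<ge>\<^sub>0" for n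
    by (induction n) (auto intro: nonneg_Reals_add_I)
  ultimately show "cinner x (transfer_operator u u a x) \<in> \<real>\<^sub>\<ge>\<^sub>0"
    unfolding sums_def
    by (intro Lim_in_closed_set[OF closed_nonneg_Reals_complex]) auto
qed

section \<open>Absolute values and compactness\<close>

lemma cadjoint_eqI:
  assumes "bounded_clinear S" "\<And>x y. cinner (T x) y = cinner x (S y)"
  shows "cadjoint T = S"
  unfolding cadjoint_def
proof (rule the_equality)
  show "bounded_clinear S \<and> (\<forall>x y. cinner (T x) y = cinner x (S y))"
    using assms by blast
  fix S' assume S': "bounded_clinear S' \<and> (\<forall>x y. cinner (T x) y = cinner x (S' y))"
  show "S' = S"
  proof
    fix y
    have "cinner (S' y - S y) (S' y - S y) = 0"
      using assms(2)[of "S' y - S y" y] S' by (simp add: cinner_diff_right)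
    thus "S' y = S y" by (simp add: cinner_self)
  qed
qed

lemma cadjoint_transfer_operator:
  assumes "orthonormal u" "orthonormal v" "\<And>j. cmod (a j) \<le> M"
  shows "cadjoint (transfer_operator u v a) = transfer_operator v u (\<lambda>j. cnj (a j))"
proof (rule cadjoint_eqI)
  show "bounded_clinear (transfer_operator v u (\<lambda>j. cnj (a j)))"
    by (rule bounded_clinear_transfer_operator[where M = M]) (use assms in auto)
qed (rule transfer_operator_adjoint[OF assms])

text \<open>
  Polarization: \<open>\<langle>z, S z\<rangle>\<close> is real, and the choices \<open>z = x + y\<close> and \<open>z = x + \<i> y\<close> give the imaginary
  and the real part of the claim.
\<close>

lemma positive_operator_selfadjoint:
  assumes "positive_operator S"
  shows "cinner (S x) y = cinner x (S y)"
proof -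
  have S: "bounded_clinear S" and pos: "\<And>x. cinner x (S x) \<in> \<real>\<^sub>\<ge>\<^sub>0"
    using assms by (auto simp: positive_operator_def)
  interpret S: bounded_linear S using bounded_clinearD[OF S] .
  have Sc: "S (c *\<^sub>C x) = c *\<^sub>C S x" for c x using bounded_clinear_scaleC[OF S] .
  have "Im (cinner z (S z)) = 0" for z
    using pos[of z] by (auto simp: complex_nonneg_Reals_iff)
  note im = this
  define p where "p = cinner x (S y)"
  define q where "q = cinner y (S x)"
  have "Im (p + q) = 0"
    using im[of "x + y"] im[of x] im[of y]
    by (simp add: S.add cinner_add_left cinner_add_right p_def q_def)
  moreover have "Im (\<i> * p - \<i> * q) = 0"
    using im[of "x + \<i> *\<^sub>C y"] im[of x] im[of y]
    by (simp add: S.add Sc cinner_add_left cinner_add_right cinner_scaleC_left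
        cinner_scaleC_right p_def q_def)
  ultimately have "p = cnj q" by (auto simp: complex_eq_iff)
  thus ?thesis unfolding p_def q_def by (metis cinner_commute)
qed

text \<open>
  This yields uniqueness of the positive square root of a diagonal operator without any functional
  calculus. If \<open>a > 0\<close>, the vector \<open>y = S x - a x\<close> satisfies \<open>S y = - a y\<close>, which positivity of \<open>S\<close>
  only allows for \<open>y = 0\<close>; if \<open>a = 0\<close>, then \<open>\<parallel>S x\<parallel>\<^sup>2 = \<langle>x, S (S x)\<rangle> = 0\<close>.
\<close>

lemma positive_square_root_eigenvector:
  assumes S: "positive_operator S" and a: "a \<ge> 0"
    and sq: "S (S x) = complex_of_real (a\<^sup>2) *\<^sub>C x"
  shows "S x = complex_of_real a *\<^sub>C x"
proof (cases "a = 0")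
  case True
  have "cinner (S x) (S x) = cinner x (S (S x))"
    by (rule positive_operator_selfadjoint[OF S])
  also have "\<dots> = 0" using True sq by (simp add: cinner_scaleC_right)
  finally show ?thesis using True by (simp add: cinner_self)
next
  case False
  have bS: "bounded_clinear S" and pos: "\<And>x. cinner x (S x) \<in> \<real>\<^sub>\<ge>\<^sub>0"
    using S by (auto simp: positive_operator_def)
  interpret S: bounded_linear S using bounded_clinearD[OF bS] .
  define y where "y = S x - complex_of_real a *\<^sub>C x"
  have Sy: "S y = - (complex_of_real a *\<^sub>C y)"
    by (simp add: y_def S.diff bounded_clinear_scaleC[OF bS] sq scaleC_scaleC power2_eq_square
        complex_vector.scale_right_diff_distrib)
  have "cinner y (S y) = - complex_of_real (a * (norm y)\<^sup>2)"
    by (simp add: Sy cinner_diff_right[of y 0, simplified] cinner_scaleC_right cinner_self)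
  with pos[of y] have "a * (norm y)\<^sup>2 \<le> 0"
    by (simp add: complex_nonneg_Reals_iff flip: of_real_power of_real_mult of_real_minus)
  with a False have "y = 0" by (simp add: mult_le_0_iff)
  thus ?thesis by (simp add: y_def)
qed

text \<open>
  The diagonal operator with entries \<open>\<bar>a\<^sub>j\<bar>\<close> is positive with the right square, and any other such
  operator agrees with it on each basis vector by the previous lemma.
\<close>

lemma abs_transfer_operator:
  assumes u: "orthonormal_basis u" and v: "orthonormal v" and aM: "\<And>j. cmod (a j) \<le> M"
  shows "abs_operator (transfer_operator u v a) =
           transfer_operator u u (\<lambda>j. complex_of_real (cmod (a j)))"
    (is "_ = ?P")
proof -
  have u': "orthonormal u" using u by (rule orthonormal_basis_imp_orthonormal)
  let ?T = "transfer_operator u v a" and ?A = "transfer_operator v u (\<lambda>j. cnj (a j))"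
  have bP: "\<And>j. cmod (complex_of_real (cmod (a j))) \<le> M" and bA: "\<And>j. cmod (cnj (a j)) \<le> M"
    using aM by auto
  have P: "positive_operator ?P" by (rule positive_transfer_operator[OF u' bP]) auto
  have AT: "?A (?T (u j)) = complex_of_real ((cmod (a j))\<^sup>2) *\<^sub>C u j" for j
    by (simp add: transfer_operator_apply[OF u' v aM] transfer_operator_scaleC[OF v u' bA]
        transfer_operator_apply[OF v u' bA] scaleC_scaleC mult_cnj_eq)
  have bcA: "bounded_clinear (\<lambda>x. ?A (?T x))"
    by (rule bounded_clinear_compose[OF bounded_clinear_transfer_operator[OF v u' bA]
        bounded_clinear_transfer_operator[OF u' v aM]])
  have bcP: "bounded_clinear ?P" using P by (simp add: positive_operator_def)
  have PP: "(\<lambda>x. ?P (?P x)) = (\<lambda>x. ?A (?T x))"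
  proof (rule bounded_clinear_eq_on_basis[OF u bounded_clinear_compose[OF bcP bcP] bcA])
    show "?P (?P (u j)) = ?A (?T (u j))" for j
      unfolding AT by (simp add: transfer_operator_apply[OF u' u' bP]
        transfer_operator_scaleC[OF u' u' bP] scaleC_scaleC power2_eq_square)
  qed
  show ?thesis
    unfolding abs_operator_def cadjoint_transfer_operator[OF u' v aM]
  proof (rule the_equality)
    show "positive_operator ?P \<and> (\<forall>x. ?P (?P x) = ?A (?T x))"
      using P PP by (auto simp: fun_eq_iff)
    fix S assume S: "positive_operator S \<and> (\<forall>x. S (S x) = ?A (?T x))"
    show "S = ?P"
    proof (rule bounded_clinear_eq_on_basis[OF u _ bcP])
      show "bounded_clinear S" using S by (simp add: positive_operator_def)
      show "S (u j) = ?P (u j)" for j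
        unfolding transfer_operator_apply[OF u' u' bP]
        by (rule positive_square_root_eigenvector) (use S AT in auto)
    qed
  qed
qed

lemma compact_finite_combinations:
  fixes v :: "nat \<Rightarrow> 'a::complex_hilbert"
  shows "compact {\<Sum>j<n. c j *\<^sub>C v j |c. \<forall>j<n. cmod (c j) \<le> M}"
proof (induction n)
  case (Suc n)
  let ?K = "{\<Sum>j<n. c j *\<^sub>C v j |c. \<forall>j<n. cmod (c j) \<le> M}"
  let ?L = "(\<lambda>z. z *\<^sub>C v n) ` cball 0 M"
  have "compact ?L"
    by (intro compact_continuous_image bounded_linear.continuous_on[OF bounded_linear_scaleC_left]
        continuous_on_id compact_cball)
  hence "compact {x + y |x y. x \<in> ?K \<and> y \<in> ?L}"
    by (intro compact_sums Suc)
  also have "{x + y |x y. x \<in> ?K \<and> y \<in> ?L} =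
      {\<Sum>j<Suc n. c j *\<^sub>C v j |c. \<forall>j<Suc n. cmod (c j) \<le> M}" (is "?lhs = ?rhs")
  proof
    show "?rhs \<subseteq> ?lhs"
    proof
      fix w assume "w \<in> ?rhs"
      then obtain c where c: "w = (\<Sum>j<n. c j *\<^sub>C v j) + c n *\<^sub>C v n" "\<forall>j<Suc n. cmod (c j) \<le> M"
        by auto
      moreover have "(\<Sum>j<n. c j *\<^sub>C v j) \<in> ?K" using c(2) by auto
      moreover have "c n *\<^sub>C v n \<in> ?L" using c(2) by auto
      ultimately show "w \<in> ?lhs" by blast
    qed
    show "?lhs \<subseteq> ?rhs"
    proof
      fix w assume "w \<in> ?lhs"
      then obtain c z where c: "w = (\<Sum>j<n. c j *\<^sub>C v j) + z *\<^sub>C v n"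
          "\<forall>j<n. cmod (c j) \<le> M" "cmod z \<le> M"
        by auto
      hence "w = (\<Sum>j<Suc n. (c(n := z)) j *\<^sub>C v j)" "\<forall>j<Suc n. cmod ((c(n := z)) j) \<le> M"
        by (auto simp: less_Suc_eq)
      thus "w \<in> ?rhs" by blast
    qed
  qed
  finally show ?case .
qed auto

text \<open>
  Discarding a tail of weights of modulus below \<open>\<epsilon>\<close> changes the operator by at most \<open>\<epsilon>\<close> in norm, and
  what remains maps the unit ball into a compact set of finite combinations. So the image of the unit
  ball is totally bounded.
\<close>

lemma compact_operator_transfer_operator:
  assumes u: "orthonormal u" and v: "orthonormal v" and a: "a \<longlonglongrightarrow> 0"
  shows "compact_operator (transfer_operator u v a)"
proof -
  let ?T = "transfer_operator u v a"
  obtain M where M: "\<And>j. cmod (a j) \<le> M"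
    using convergent_imp_Bseq[OF convergentI[OF a]] by (auto simp: Bseq_def)
  have "\<exists>k. finite k \<and> closure (?T ` cball 0 1) \<subseteq> (\<Union>x\<in>k. ball x e)" if e: "e > 0" for e
  proof -
    obtain N where N: "\<And>j. j \<ge> N \<Longrightarrow> cmod (a j) < e / 3"
      using LIMSEQ_D[OF a, of "e / 3"] e by auto
    define K where "K = {\<Sum>j<N. c j *\<^sub>C v j |c. \<forall>j<N. cmod (c j) \<le> M}"
    have "compact K" unfolding K_def by (rule compact_finite_combinations)
    then obtain k where k: "finite k" "K \<subseteq> (\<Union>x\<in>k. ball x (e / 3))"
      unfolding compact_eq_totally_bounded using e by (meson divide_pos_pos zero_less_numeral)
    have "?T x \<in> (\<Union>z\<in>k. cball z (2 * e / 3))" if x: "norm x \<le> 1" for x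
    proof -
      \<comment> \<open>weights of the tail, whose operator has norm at most \<open>e / 3\<close>\<close>
      define b where "b = (\<lambda>j. if j < N then 0 else a j)"
      have bM: "cmod (b j) \<le> e / 3" for j
        using N[of j] e by (simp add: b_def less_imp_le)
      have "(\<lambda>j. (a j * cinner (u j) x) *\<^sub>C v j - (b j * cinner (u j) x) *\<^sub>C v j) sums
              (?T x - transfer_operator u v b x)"
        by (intro sums_diff transfer_operator_sums[OF u v M] transfer_operator_sums[OF u v bM])
      also have "(\<lambda>j. (a j * cinner (u j) x) *\<^sub>C v j - (b j * cinner (u j) x) *\<^sub>C v j)
          = (\<lambda>j. if j \<in> {..<N} then (a j * cinner (u j) x) *\<^sub>C v j else 0)"
        by (auto simp: b_def fun_eq_iff)
      finally have "?T x - transfer_operator u v b x = (\<Sum>j<N. (a j * cinner (u j) x) *\<^sub>C v j)"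
        by (rule sums_unique2) (rule sums_If_finite_set, simp)
      also have "\<dots> \<in> K"
      proof -
        have "cmod (a j * cinner (u j) x) \<le> M" for j
        proof -
          have "norm (u j) = 1"
            using cinner_self[of "u j"] orthonormalD[OF u, of j j] norm_ge_zero[of "u j"]
            by (metis of_real_1 of_real_eq_iff one_power2 power2_eq_imp_eq zero_le_one)
          hence "cmod (cinner (u j) x) \<le> 1"
            using Cauchy_Schwarz_cinner[of "u j" x] x by simp
          thus ?thesis
            using mult_mono[OF M, of "cmod (cinner (u j) x)" 1 j] order_trans[OF norm_ge_zero M]
            by (simp add: norm_mult)
        qed
        thus ?thesis
          unfolding K_def by (intro CollectI exI[of _ "\<lambda>j. a j * cinner (u j) x"]) simp
      qed
      finally obtain z where z: "z \<in> k" "dist z (?T x - transfer_operator u v b x) < e / 3"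
        using k by auto
      have "norm (transfer_operator u v b x) \<le> e / 3 * norm x"
        by (rule norm_transfer_operator_le[OF u v bM])
      also have "\<dots> \<le> e / 3" using x e by simp
      finally have "dist z (?T x) \<le> 2 * e / 3"
        using z(2) norm_triangle_ineq4[of "z - (?T x - transfer_operator u v b x)"
            "transfer_operator u v b x"]
        by (simp add: dist_norm)
      thus ?thesis using z(1) by auto
    qed
    hence "closure (?T ` cball 0 1) \<subseteq> (\<Union>z\<in>k. cball z (2 * e / 3))"
      using k(1) by (intro closure_minimal closed_UN) auto
    also have "\<dots> \<subseteq> (\<Union>z\<in>k. ball z e)" using e by fastforce
    finally show ?thesis using k(1) by blast
  qed
  moreover have "complete (closure (?T ` cball 0 1))" by (simp add: complete_eq_closed)
  ultimately show ?thesis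
    unfolding compact_operator_def compact_eq_totally_bounded
    using bounded_clinear_transfer_operator[where a = a, OF u v M] by blast
qed

section \<open>Eigenvalues of diagonal operators\<close>

lemma inj_orthonormal: "orthonormal u \<Longrightarrow> inj u"
  by (rule injI) (metis orthonormalD zero_neq_one)

lemma independent_orthonormal:
  assumes u: "orthonormal u" and F: "finite F"
  shows "complex_vector.independent (u ` F)"
proof (rule complex_vector.independent_if_scalars_zero)
  fix f x assume sum: "(\<Sum>x\<in>u ` F. f x *\<^sub>C x) = 0" and x: "x \<in> u ` F"
  then obtain i where i: "i \<in> F" "x = u i" by auto
  have "0 = cinner (u i) (\<Sum>j\<in>F. f (u j) *\<^sub>C u j)"
    using sum inj_orthonormal[OF u] by (simp add: sum.reindex inj_on_def inj_def)
  also have "\<dots> = (\<Sum>j\<in>F. if i = j then f (u j) else 0)"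
    unfolding cinner_sum_right cinner_scaleC_right
    by (intro sum.cong) (auto simp: orthonormalD[OF u])
  also have "\<dots> = f (u i)" using i F by simp
  finally show "f x = 0" using i by simp
qed (use F in simp)

text \<open>
  On the \<open>j\<close>-th coordinate the \<open>n\<close>-th power of \<open>T - z\<close> acts as multiplication by
  \<open>(a\<^sub>j - z)\<^sup>n\<close>, so that root vectors are supported on the indices with \<open>a\<^sub>j = z\<close>: generalized
  eigenvectors are eigenvectors.
\<close>

lemma multiplicity_at_diagonal:
  assumes u: "orthonormal_basis u" and aM: "\<And>j. cmod (a j) \<le> M" and fin: "finite {j. a j = z}"
  shows "multiplicity_at (transfer_operator u u a) z = card {j. a j = z}"
proof -
  define T where "T = transfer_operator u u a"
  define F where "F = {j. a j = z}"
  define N where "N = (\<lambda>y. T y - z *\<^sub>C y)"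
  have u': "orthonormal u" using u by (rule orthonormal_basis_imp_orthonormal)
  have coeff: "cinner (u j) ((N ^^ n) x) = (a j - z) ^ n * cinner (u j) x" for j n x
    by (induction n) (simp_all add: N_def T_def cinner_diff_right cinner_scaleC_right
        cinner_transfer_operator[OF u' u' aM] algebra_simps)
  have "(\<Union>n. {x. (N ^^ n) x = 0}) = complex_vector.span (u ` F)"
  proof
    show "(\<Union>n. {x. (N ^^ n) x = 0}) \<subseteq> complex_vector.span (u ` F)"
    proof
      fix x assume "x \<in> (\<Union>n. {x. (N ^^ n) x = 0})"
      then obtain n where "(N ^^ n) x = 0" by auto
      hence zero: "cinner (u j) x = 0" if "j \<notin> F" for j
        using coeff[of j n x] that by (simp add: F_def)
      have "x = (\<Sum>i\<in>F. cinner (u i) x *\<^sub>C u i)"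
      proof (rule orthonormal_basis_eqI[OF u])
        fix j
        have "cinner (u j) (\<Sum>i\<in>F. cinner (u i) x *\<^sub>C u i)
            = (\<Sum>i\<in>F. if j = i then cinner (u i) x else 0)"
          unfolding cinner_sum_right cinner_scaleC_right
          by (intro sum.cong) (auto simp: orthonormalD[OF u'])
        also have "\<dots> = cinner (u j) x"
          using zero[of j] fin by (simp add: F_def)
        finally show "cinner (u j) x = cinner (u j) (\<Sum>i\<in>F. cinner (u i) x *\<^sub>C u i)" ..
      qed
      also have "\<dots> \<in> complex_vector.span (u ` F)"
        by (intro complex_vector.span_sum complex_vector.span_scale complex_vector.span_base) auto
      finally show "x \<in> complex_vector.span (u ` F)" .
    qed
    have "complex_vector.span (u ` F) \<subseteq> {x. N x = 0}"
    proof (rule complex_vector.span_minimal)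
      have T: "bounded_clinear T" unfolding T_def by (rule bounded_clinear_transfer_operator[OF u' u' aM])
      interpret T: bounded_linear T using bounded_clinearD[OF T] .
      show "complex_vector.subspace {x. N x = 0}"
        by (rule complex_vector.subspaceI)
           (auto simp: N_def T.zero T.add bounded_clinear_scaleC[OF T] scaleC_add_right
             scaleC_scaleC mult.commute)
      show "u ` F \<subseteq> {x. N x = 0}"
        by (auto simp: F_def N_def T_def transfer_operator_apply[OF u' u' aM])
    qed
    also have "{x. N x = 0} \<subseteq> (\<Union>n. {x. (N ^^ n) x = 0})"
    proof
      fix x assume "x \<in> {x. N x = 0}"
      hence "(N ^^ 1) x = 0" by simp
      thus "x \<in> (\<Union>n. {x. (N ^^ n) x = 0})" by blast
    qed
    finally show "complex_vector.span (u ` F) \<subseteq> (\<Union>n. {x. (N ^^ n) x = 0})" .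
  qed
  hence "multiplicity_at T z = complex_vector.dim (complex_vector.span (u ` F))"
    by (simp add: multiplicity_at_def N_def)
  also have "\<dots> = card (u ` F)"
    using fin by (intro complex_vector.dim_span_eq_card_independent independent_orthonormal u')
                 (simp add: F_def)
  also have "\<dots> = card F"
    by (intro card_image inj_on_subset[OF inj_orthonormal[OF u']]) auto
  finally show ?thesis by (simp add: T_def F_def)
qed

lemma finite_level_set_null_sequence:
  fixes a :: "nat \<Rightarrow> 'b::real_normed_vector"
  assumes a: "a \<longlonglongrightarrow> 0" and t: "t > 0"
  shows "finite {j. norm (a j) \<ge> t}"
proof -
  obtain N where "\<And>j. j \<ge> N \<Longrightarrow> norm (a j) < t"
    using LIMSEQ_D[OF a t] by auto
  hence "{j. norm (a j) \<ge> t} \<subseteq> {..<N}" by (auto simp: not_le[symmetric])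
  thus ?thesis by (rule finite_subset) auto
qed

text \<open>
  Order the indices of positive entries by decreasing value, ties being broken by the index. Every
  such index has finitely many predecessors, and their number is its position in the rearrangement.
  Positions form an initial segment of \<open>\<nat>\<close>, because the predecessors of an index at position \<open>r\<close>
  occupy the \<open>r\<close> positions below it; the remaining positions are filled with zeros.
\<close>

lemma decreasing_rearrangement:
  fixes a :: "nat \<Rightarrow> real"
  assumes a: "a \<longlonglongrightarrow> 0" and nonneg: "\<And>j. a j \<ge> 0"
  obtains l :: "nat \<Rightarrow> real" where "antimono l" "\<And>j. l j \<ge> 0"
    "\<And>t. t > 0 \<Longrightarrow> finite {j. l j = t} \<and> card {j. l j = t} = card {j. a j = t}"
proof -
  define I where "I = {j. a j > 0}"
  define P where "P i = {k. a k > a i \<or> (a k = a i \<and> k < i)}" for i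
  define rank where "rank i = card (P i)" for i
  have fin: "finite (P i)" if "i \<in> I" for i
  proof (rule finite_subset)
    show "P i \<subseteq> {j. norm (a j) \<ge> a i}" by (auto simp: P_def)
    show "finite {j. norm (a j) \<ge> a i}"
      using finite_level_set_null_sequence[OF a] that by (auto simp: I_def)
  qed
  have PI: "P i \<subseteq> I" if "i \<in> I" for i using that by (auto simp: P_def I_def)
  have less: "rank k < rank i" if "i \<in> I" "k \<in> P i" for i k
    unfolding rank_def using that by (intro psubset_card_mono fin) (auto simp: P_def)
  have total: "i \<in> P k \<or> k \<in> P i" if "i \<noteq> k" for i k
    using that by (auto simp: P_def)
  have inj: "inj_on rank I"
    by (rule inj_onI) (metis total less less_irrefl)
  have init: "r \<in> rank ` I" if i: "i \<in> I" and r: "r < rank i" for i r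
  proof -
    have "rank ` P i = {..<rank i}"
    proof (rule card_subset_eq)
      show "rank ` P i \<subseteq> {..<rank i}" using less[OF i] by auto
      show "card (rank ` P i) = card {..<rank i}"
        unfolding card_image[OF inj_on_subset[OF inj PI[OF i]]] by (simp add: rank_def)
    qed auto
    hence "r \<in> rank ` P i" using r by simp
    thus ?thesis using PI[OF i] by blast
  qed
  define l where "l j = (if j \<in> rank ` I then a (inv_into I rank j) else 0)" for j
  have l_rank: "l (rank i) = a i" if "i \<in> I" for i
    using that inj by (simp add: l_def)
  have l_out: "l j = 0" if "j \<notin> rank ` I" for j using that by (simp add: l_def)
  show ?thesis
  proof
    show l0: "l j \<ge> 0" for j by (simp add: l_def nonneg)
    show "antimono l"
    proof
      fix j k :: nat assume jk: "j \<le> k"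
      show "l k \<le> l j"
      proof (cases "k \<in> rank ` I")
        case True
        then obtain i where i: "i \<in> I" "k = rank i" by auto
        have "j \<in> rank ` I" using init[OF i(1), of j] jk i by (cases "j = k") auto
        then obtain i' where i': "i' \<in> I" "j = rank i'" by auto
        have "i \<notin> P i'" using less[OF i'(1), of i] jk i(2) i'(2) by auto
        hence "a i \<le> a i'" by (auto simp: P_def)
        thus ?thesis by (simp add: i i' l_rank)
      qed (simp add: l_out l0)
    qed
    fix t :: real assume t: "t > 0"
    have eq: "{j. l j = t} = rank ` {i. a i = t}"
    proof
      show "{j. l j = t} \<subseteq> rank ` {i. a i = t}"
        using t l_out l_rank by fastforce
      show "rank ` {i. a i = t} \<subseteq> {j. l j = t}"
        using t l_rank by (auto simp: I_def)
    qed
    have "finite {i. a i = t}"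
      by (rule finite_subset[OF _ finite_level_set_null_sequence[OF a t]]) auto
    moreover have "inj_on rank {i. a i = t}"
      using t by (intro inj_on_subset[OF inj]) (auto simp: I_def)
    ultimately show "finite {j. l j = t} \<and> card {j. l j = t} = card {j. a j = t}"
      by (simp add: eq card_image)
  qed
qed

text \<open>
  If \<open>\<bar>l\<^sub>j\<bar> > b\<^sub>j\<close>, then at least \<open>j + 1\<close> entries of \<open>l\<close> have modulus above \<open>b\<^sub>j\<close>, whereas such values
  occur in \<open>a\<close> only at indices below \<open>j\<close>. The counts must agree. This replaces an explicit
  description of the sorted sequence, which would depend on the choice made among equal moduli.
\<close>

lemma rearrangement_bound:
  fixes l a :: "nat \<Rightarrow> complex"
  assumes l: "antimono (\<lambda>j. cmod (l j))"
    and fl: "\<And>z. z \<noteq> 0 \<Longrightarrow> finite {j. l j = z}"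
    and fa: "\<And>z. z \<noteq> 0 \<Longrightarrow> finite {j. a j = z}"
    and card: "\<And>z. z \<noteq> 0 \<Longrightarrow> card {j. l j = z} = card {j. a j = z}"
    and ab: "\<And>j. cmod (a j) \<le> b j" and b: "antimono b"
  shows "cmod (l j) \<le> b j"
proof (rule ccontr)
  assume "\<not> ?thesis"
  hence gt: "b j < cmod (l j)" by simp
  have b0: "b j \<ge> 0" using ab[of j] norm_ge_zero order_trans by blast
  define Z where "Z = l ` {..j}"
  have Z: "cmod z > b j" if "z \<in> Z" for z
    using that gt antimonoD[OF l, of _ j] by (force simp: Z_def)
  hence Z0: "z \<noteq> 0" if "z \<in> Z" for z using that b0 by fastforce
  have finZ: "finite Z" by (simp add: Z_def)
  have cl: "card {i. l i \<in> Z} = (\<Sum>z\<in>Z. card {i. l i = z})"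
  proof -
    have "{i. l i \<in> Z} = (\<Union>z\<in>Z. {i. l i = z})" by auto
    thus ?thesis using card_UN_disjoint[OF finZ, of "\<lambda>z. {i. l i = z}"] fl Z0 by auto
  qed
  have ca: "card {i. a i \<in> Z} = (\<Sum>z\<in>Z. card {i. a i = z})"
  proof -
    have "{i. a i \<in> Z} = (\<Union>z\<in>Z. {i. a i = z})" by auto
    thus ?thesis using card_UN_disjoint[OF finZ, of "\<lambda>z. {i. a i = z}"] fa Z0 by auto
  qed
  have "finite (\<Union>z\<in>Z. {i. l i = z})" using finZ fl Z0 by blast
  moreover have "{i. l i \<in> Z} = (\<Union>z\<in>Z. {i. l i = z})" by auto
  ultimately have "card {..j} \<le> card {i. l i \<in> Z}"
    by (intro card_mono) (auto simp: Z_def)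
  also have "\<dots> = card {i. a i \<in> Z}"
    unfolding cl ca by (intro sum.cong refl card Z0)
  also have "\<dots> \<le> card {..<j}"
  proof (intro card_mono subsetI)
    fix i assume "i \<in> {i. a i \<in> Z}"
    hence "b j < b i" using Z[of "a i"] ab[of i] by auto
    thus "i \<in> {..<j}" using antimonoD[OF b, of j i] by (cases "i < j") auto
  qed auto
  finally show False by simp
qed

lemma finite_fibre_null_sequence:
  fixes a :: "nat \<Rightarrow> complex"
  assumes "a \<longlonglongrightarrow> 0" "z \<noteq> 0" shows "finite {j. a j = z}"
  by (rule finite_subset[OF _ finite_level_set_null_sequence[OF assms(1), of "cmod z"]])
     (use assms in auto)

lemma eigenvalue_sequence_diagonal_iff:
  assumes u: "orthonormal_basis u" and a: "a \<longlonglongrightarrow> 0"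
  shows "eigenvalue_sequence (transfer_operator u u a) l \<longleftrightarrow>
     antimono (\<lambda>j. cmod (l j)) \<and>
     (\<forall>z. z \<noteq> 0 \<longrightarrow> finite {j. l j = z} \<and> card {j. l j = z} = card {j. a j = z})"
proof -
  obtain M where M: "\<And>j. cmod (a j) \<le> M"
    using convergent_imp_Bseq[OF convergentI[OF a]] by (auto simp: Bseq_def)
  show ?thesis
    unfolding eigenvalue_sequence_def
    using multiplicity_at_diagonal[OF u M finite_fibre_null_sequence[OF a]] by auto
qed

text \<open>
  The rearrangement supplies some eigenvalue sequence, without which the choice in
  \<^const>\<open>eigenvalues\<close> would be arbitrary; every eigenvalue sequence then satisfies the bound.
\<close>

lemma eigenvalues_diagonal_le:
  fixes a :: "nat \<Rightarrow> real"
  assumes u: "orthonormal_basis u" and a0: "\<And>j. a j \<ge> 0" and ab: "\<And>j. a j \<le> b j"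
    and b: "antimono b" "b \<longlonglongrightarrow> 0"
  defines "T \<equiv> transfer_operator u u (\<lambda>j. complex_of_real (a j))"
  shows "eigenvalue_sequence T (eigenvalues T)" "cmod (eigenvalues T j) \<le> b j"
proof -
  have a: "a \<longlonglongrightarrow> 0"
    by (rule tendsto_sandwich[OF _ _ tendsto_const b(2)]) (use a0 ab in auto)
  hence a': "(\<lambda>j. complex_of_real (a j)) \<longlonglongrightarrow> 0"
    using tendsto_of_real[OF a, where 'a = complex] by simp
  obtain l :: "nat \<Rightarrow> real" where l: "antimono l" "\<And>j. l j \<ge> 0"
    "\<And>t. t > 0 \<Longrightarrow> finite {j. l j = t} \<and> card {j. l j = t} = card {j. a j = t}"
    using decreasing_rearrangement[OF a a0] by blast
  have "eigenvalue_sequence T (\<lambda>j. complex_of_real (l j))"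
    unfolding T_def eigenvalue_sequence_diagonal_iff[OF u a']
  proof (intro conjI allI impI)
    show "antimono (\<lambda>j. cmod (complex_of_real (l j)))"
      using l(1,2) by simp
    fix z :: complex assume z: "z \<noteq> 0"
    have "finite {j. complex_of_real (l j) = z} \<and>
        card {j. complex_of_real (l j) = z} = card {j. complex_of_real (a j) = z}"
    proof (cases "\<exists>t>0. z = complex_of_real t")
      case True
      then obtain t where "t > 0" "z = complex_of_real t" by auto
      thus ?thesis using l(3)[of t] by auto
    next
      case False
      hence "complex_of_real (l j) \<noteq> z" "complex_of_real (a j) \<noteq> z" for j
        using z l(2)[of j] a0[of j] by (auto simp: order_le_less)
      thus ?thesis by auto
    qed
    thus "finite {j. complex_of_real (l j) = z}"
      "card {j. complex_of_real (l j) = z} = card {j. complex_of_real (a j) = z}" by auto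
  qed
  thus seq: "eigenvalue_sequence T (eigenvalues T)" unfolding eigenvalues_def by (rule someI[where P = "eigenvalue_sequence T"])
  show "cmod (eigenvalues T j) \<le> b j"
  proof (rule rearrangement_bound[OF _ _ finite_fibre_null_sequence[OF a'] _ _ b(1)])
    show "cmod (complex_of_real (a j)) \<le> b j" for j using a0 ab by simp
  qed (use seq in \<open>auto simp: T_def eigenvalue_sequence_diagonal_iff[OF u a']\<close>)
qed

text \<open>
  The counting bound in both directions determines the moduli, and a nonzero eigenvalue, being
  an entry of \<open>a\<close>, equals its modulus.
\<close>

lemma eigenvalues_decreasing_diagonal:
  fixes a :: "nat \<Rightarrow> real"
  assumes u: "orthonormal_basis u" and a: "antimono a" "a \<longlonglongrightarrow> 0"
  shows "eigenvalues (transfer_operator u u (\<lambda>j. complex_of_real (a j))) = (\<lambda>j. complex_of_real (a j))"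
proof
  fix j
  define T where "T = transfer_operator u u (\<lambda>j. complex_of_real (a j))"
  define l where "l = eigenvalues T"
  have a0: "a j \<ge> 0" for j
    using a by (intro decseq_ge) auto
  have a': "(\<lambda>j. complex_of_real (a j)) \<longlonglongrightarrow> 0"
    using tendsto_of_real[OF a(2), where 'a = complex] by simp
  have "eigenvalue_sequence T l"
    unfolding l_def T_def by (rule eigenvalues_diagonal_le[OF u a0 order_refl a])
  hence l: "antimono (\<lambda>j. cmod (l j))" "\<And>z. z \<noteq> 0 \<Longrightarrow> finite {j. l j = z}"
      "\<And>z. z \<noteq> 0 \<Longrightarrow> card {j. l j = z} = card {j. complex_of_real (a j) = z}"
    by (auto simp: T_def eigenvalue_sequence_diagonal_iff[OF u a'])
  have "cmod (l j) \<le> a j"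
    unfolding l_def T_def by (rule eigenvalues_diagonal_le[OF u a0 order_refl a])
  moreover have "cmod (complex_of_real (a j)) \<le> cmod (l j)"
    by (rule rearrangement_bound[OF _ finite_fibre_null_sequence[OF a'] l(2) l(3)[symmetric] order_refl l(1)])
       (use a a0 in auto)
  ultimately have *: "cmod (l j) = a j" using a0[of j] by simp
  show "l j = complex_of_real (a j)"
  proof (cases "l j = 0")
    case False
    hence "card {i. complex_of_real (a i) = l j} \<noteq> 0"
      using l(2,3)[OF False] by (metis card_eq_0_iff empty_iff mem_Collect_eq)
    then obtain i where "l j = complex_of_real (a i)"
      by (metis (mono_tags, lifting) card.empty empty_Collect_eq)
    thus ?thesis using * a0[of i] by simp
  qed (use * in simp)
qed

lemma transfer_operator_in_weak_lorentz:
  assumes u: "orthonormal_basis u" and v: "orthonormal v"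
    and a: "\<And>j. cmod (a j) \<le> C * g (real j)"
    and g: "antimono (\<lambda>j. g (real j))" "(\<lambda>j. g (real j)) \<longlonglongrightarrow> 0"
  shows "transfer_operator u v a \<in> weak_lorentz g"
proof -
  define C' where "C' = max C 0"
  have g0: "g (real j) \<ge> 0" for j :: nat by (rule decseq_ge[OF g])
  have a': "cmod (a j) \<le> C' * g (real j)" for j
    by (rule order_trans[OF a]) (auto simp: C'_def intro: mult_right_mono g0)
  have lim: "(\<lambda>j. C' * g (real j)) \<longlonglongrightarrow> 0" using tendsto_mult_left[OF g(2), of C'] by simp
  have mono: "antimono (\<lambda>j. C' * g (real j))"
    using g(1) by (auto simp: C'_def antimono_def intro!: mult_left_mono)
  have null: "a \<longlonglongrightarrow> 0"
    by (rule Lim_null_comparison[OF _ lim]) (use a' in auto)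
  then obtain M where M: "\<And>j. cmod (a j) \<le> M"
    using convergent_imp_Bseq[OF convergentI] by (fastforce simp: Bseq_def)
  have "cmod (singular_value (transfer_operator u v a) j) \<le> C' * g (real j)" for j
  proof -
    have "cmod (eigenvalues (abs_operator (transfer_operator u v a)) j) \<le> C' * g (real j)"
      unfolding abs_transfer_operator[OF u v M]
      by (rule eigenvalues_diagonal_le(2)[OF u _ a' mono lim]) auto
    thus ?thesis unfolding singular_value_def
      by (metis abs_Re_le_cmod norm_of_real order_trans)
  qed
  hence "(\<lambda>j. singular_value (transfer_operator u v a) j) \<in> O(\<lambda>j. g (real j))"
    by (intro bigoI[of _ C'] always_eventually) (use g0 in auto)
  thus ?thesis
    using compact_operator_transfer_operator[OF orthonormal_basis_imp_orthonormal[OF u] v null]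
    by (simp add: weak_lorentz_def)
qed

section \<open>Existence of extended limits\<close>

text \<open>
  Existence of extended limits is needed for the noncommutative integral to be well determined.
  The evaluations at the \<open>n\<close>-th entry lie in a product of closed discs, which is compact by Tychonoff's
  theorem, and any cluster point of this sequence is an extended limit: each defining condition is
  closed and holds, at least asymptotically, along the sequence.
\<close>

lemma extended_limit_exists: "\<exists>\<omega>. extended_limit \<omega>"
proof -
  define B :: "(nat \<Rightarrow> complex) \<Rightarrow> real" where
    "B a = (if Bseq a then SOME K. \<forall>n. cmod (a n) \<le> K else 0)" for a
  define p :: "nat \<Rightarrow> (nat \<Rightarrow> complex) \<Rightarrow> complex" where
    "p n a = (if Bseq a then a n else 0)" for n a
  have B: "cmod (p n a) \<le> B a" for n a
  proof (cases "Bseq a")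
    case True
    hence "\<exists>K. \<forall>n. cmod (a n) \<le> K" by (auto simp: Bseq_def)
    hence "\<forall>n. cmod (a n) \<le> (SOME K. \<forall>n. cmod (a n) \<le> K)" by (rule someI_ex)
    thus ?thesis using True by (simp add: p_def B_def)
  qed (simp add: p_def B_def)
  let ?K = "PiE UNIV (\<lambda>a. cball (0::complex) (B a))"
  define F where "F = filtermap p sequentially"
  have "compactin (product_topology (\<lambda>_. euclidean) UNIV) ?K"
    unfolding compactin_PiE by (simp add: compact_cball)
  hence "compact ?K" by (simp add: euclidean_product_topology)
  moreover have "F \<noteq> bot" by (simp add: F_def filtermap_bot_iff)
  moreover have "eventually (\<lambda>f. f \<in> ?K) F"
    using B by (simp add: F_def eventually_filtermap PiE_def Pi_def)
  ultimately obtain w where w: "inf (nhds w) F \<noteq> bot"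
    unfolding compact_filter by blast
  define F' where "F' = inf (nhds w) F"
  have F': "F' \<noteq> bot" "F' \<le> F" using w by (auto simp: F'_def)
  have lim: "((\<lambda>f. f a) \<longlongrightarrow> w a) F'" for a
  proof -
    have "((\<lambda>f. f a) \<longlongrightarrow> w a) (nhds w)"
    proof (rule topological_tendstoI)
      fix S assume S: "open S" "w a \<in> S"
      have "open ((\<lambda>f::(nat \<Rightarrow> complex) \<Rightarrow> complex. f a) -` S)"
        by (intro open_vimage S continuous_on_product_coordinates)
      thus "eventually (\<lambda>f. f a \<in> S) (nhds w)"
        using S(2) unfolding eventually_nhds by blast
    qed
    thus ?thesis by (rule tendsto_mono[rotated]) (simp add: F'_def)
  qed
  have ev: "eventually P F'" if "\<And>n. P (p n)" for P
    using F'(2) by (rule filter_leD) (use that in \<open>auto simp: F_def eventually_filtermap\<close>)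
  have "extended_limit w"
    unfolding extended_limit_def
  proof (intro conjI allI impI)
    fix a b :: "nat \<Rightarrow> complex" assume ab: "Bseq a \<and> Bseq b"
    then obtain K L where "\<And>n. cmod (a n) \<le> K" "\<And>n. cmod (b n) \<le> L"
      by (auto simp: Bseq_def)
    hence "Bseq (\<lambda>n. a n + b n)"
      by (intro BseqI'[of _ "K + L"] norm_triangle_le add_mono)
    hence "eventually (\<lambda>f. f a + f b = f (\<lambda>n. a n + b n)) F'"
      using ab by (intro ev) (simp add: p_def)
    hence "((\<lambda>f. f (\<lambda>n. a n + b n)) \<longlongrightarrow> w a + w b) F'"
      by (rule Lim_transform_eventually[rotated]) (intro tendsto_add lim)
    with lim show "w (\<lambda>n. a n + b n) = w a + w b" by (rule tendsto_unique[OF F'(1)])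
  next
    fix c :: complex and a :: "nat \<Rightarrow> complex" assume a: "Bseq a"
    hence "Bseq (\<lambda>n. c * a n)" using Bseq_mult[of "\<lambda>_. c" a] by auto
    hence "eventually (\<lambda>f. c * f a = f (\<lambda>n. c * a n)) F'"
      using a by (intro ev) (simp add: p_def)
    hence "((\<lambda>f. f (\<lambda>n. c * a n)) \<longlongrightarrow> c * w a) F'"
      by (rule Lim_transform_eventually[rotated]) (intro tendsto_mult tendsto_const lim)
    with lim show "w (\<lambda>n. c * a n) = c * w a" by (rule tendsto_unique[OF F'(1)])
  next
    fix a :: "nat \<Rightarrow> complex" assume a: "Bseq a \<and> (\<forall>n. a n \<in> \<real>\<^sub>\<ge>\<^sub>0)"
    have "eventually (\<lambda>f. f a \<in> \<real>\<^sub>\<ge>\<^sub>0) F'" using a by (intro ev) (simp add: p_def)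
    thus "w a \<in> \<real>\<^sub>\<ge>\<^sub>0"
      by (rule Lim_in_closed_set[OF closed_nonneg_Reals_complex _ F'(1) lim])
  next
    fix a :: "nat \<Rightarrow> complex" and l assume a: "a \<longlonglongrightarrow> l"
    have "p n a = a n" for n
      using convergent_imp_Bseq[OF convergentI[OF a]] by (simp add: p_def)
    hence "((\<lambda>f. f a) \<longlongrightarrow> l) F" using a by (simp add: F_def filterlim_filtermap)
    hence "((\<lambda>f. f a) \<longlongrightarrow> l) F'" by (rule tendsto_mono[OF F'(2)])
    with lim show "w a = l" by (rule tendsto_unique[OF F'(1)])
  qed
  thus ?thesis by blast
qed

section \<open>Dyadic blocks\<close>

definition block_index :: "nat \<Rightarrow> nat" where
  "block_index j = floor_log (Suc j)"

text \<open>The dyadic block on which the eigenvalues of the operator in the theorem are constant.\<close>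

definition block :: "nat \<Rightarrow> nat set" where
  "block m = {2 ^ m - 1..2 ^ (m + 1) - 2}"

lemma block_alt: "block m = {2 ^ m - 1..<2 ^ Suc m - 1}"
proof -
  have "(2::nat) ^ m \<ge> 1" by simp
  hence "2 ^ (m + 1) - 2 < (2::nat) ^ Suc m - 1"
    unfolding Suc_eq_plus1 power_add power_one_right by arith
  thus ?thesis unfolding block_def by auto
qed

lemma finite_block [simp]: "finite (block m)"
  by (simp add: block_def)

lemma card_block: "card (block m) = 2 ^ m"
  unfolding block_alt by simp

lemma mem_block_iff: "j \<in> block m \<longleftrightarrow> block_index j = m"
proof
  assume j: "j \<in> block m"
  hence 1: "2 ^ m \<le> Suc j" "Suc j < 2 * 2 ^ m" unfolding block_alt by auto
  have "m \<le> floor_log (Suc j)" using floor_log_le_iff[OF 1(1)] by simp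
  moreover have "2 ^ floor_log (Suc j) < (2::nat) ^ Suc m"
    using le_less_trans[OF floor_log_exp2_le[of "Suc j"] 1(2)] by simp
  hence "floor_log (Suc j) < Suc m" by (rule power_less_imp_less_exp[rotated]) simp
  ultimately show "block_index j = m" by (simp add: block_index_def)
next
  assume "block_index j = m"
  thus "j \<in> block m"
    using floor_log_exp2_le[of "Suc j"] floor_log_exp2_gt[of "Suc j"]
    unfolding block_alt by (auto simp: block_index_def)
qed

lemma block_index_add: "i < 2 ^ m \<Longrightarrow> block_index (2 ^ m - 1 + i) = m"
  unfolding mem_block_iff[symmetric] block_alt by auto

lemma filterlim_block_index: "filterlim block_index at_top sequentially"
  unfolding filterlim_at_top
proof
  fix Z :: nat
  show "eventually (\<lambda>n. Z \<le> block_index n) sequentially"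
    using eventually_ge_at_top[of "2 ^ Z"]
  proof eventually_elim
    case (elim n)
    thus ?case using floor_log_le_iff[of "2 ^ Z" "Suc n"] by (simp add: block_index_def)
  qed
qed

text \<open>
  Always continue with a term of sign opposite to the running sum. Such a term exists as long as the
  running sum is nonzero, since the total is zero, and adding it cannot leave the interval
  \<open>[- M, M]\<close>. The starting value \<open>s\<close> is there for the induction.
\<close>

lemma bounded_partial_sums_ordering:
  fixes f :: "'b \<Rightarrow> real"
  assumes "finite A" "\<And>x. x \<in> A \<Longrightarrow> \<bar>f x\<bar> \<le> M" "s + sum f A = 0" "\<bar>s\<bar> \<le> M"
  shows "\<exists>xs. distinct xs \<and> set xs = A \<and> (\<forall>i. \<bar>s + sum_list (map f (take i xs))\<bar> \<le> M)"
  using assms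
proof (induction "card A" arbitrary: A s)
  case 0
  thus ?case by (intro exI[of _ "[]"]) auto
next
  case (Suc n)
  have "A \<noteq> {}" using Suc.hyps(2) by auto
  have "\<exists>x\<in>A. \<bar>s + f x\<bar> \<le> M"
  proof (cases "s = 0")
    case True
    thus ?thesis using \<open>A \<noteq> {}\<close> Suc.prems(2) by auto
  next
    case False
    \<comment> \<open>the remaining sum has the sign opposite to \<open>s\<close>\<close>
    have "\<exists>x\<in>A. s * f x < 0"
    proof (rule ccontr)
      assume "\<not> ?thesis"
      hence "(\<Sum>x\<in>A. s * f x) \<ge> 0" by (intro sum_nonneg) (auto simp: not_less)
      also have "(\<Sum>x\<in>A. s * f x) = - (s * s)"
        using Suc.prems(3) by (simp add: sum_distrib_left[symmetric] eq_neg_iff_add_eq_0 distrib_left[symmetric] add.commute)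
      finally show False using False by (simp add: mult_le_0_iff) linarith
    qed
    then obtain x where "x \<in> A" "s * f x < 0" by blast
    moreover from this have "\<bar>s + f x\<bar> \<le> M"
      using Suc.prems(2)[of x] Suc.prems(4) by (auto simp: mult_less_0_iff abs_le_iff)
    ultimately show ?thesis by blast
  qed
  then obtain x where x: "x \<in> A" "\<bar>s + f x\<bar> \<le> M" by blast
  have "\<exists>xs. distinct xs \<and> set xs = A - {x} \<and>
          (\<forall>i. \<bar>(s + f x) + sum_list (map f (take i xs))\<bar> \<le> M)"
    using Suc.hyps(2) Suc.prems x
    by (intro Suc.hyps(1)) (auto simp: sum_diff1)
  then obtain xs where xs: "distinct xs" "set xs = A - {x}"
      "\<And>i. \<bar>(s + f x) + sum_list (map f (take i xs))\<bar> \<le> M"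
    by blast
  have "\<bar>s + sum_list (map f (take i (x # xs)))\<bar> \<le> M" for i
    using xs(3)[of "i - 1"] Suc.prems(4) by (cases i) (auto simp: add.assoc)
  moreover have "distinct (x # xs)" "set (x # xs) = A" using xs x by auto
  ultimately show ?case by blast
qed

text \<open>
  The orderings of the blocks are concatenated. As every block sums to zero, only the terms from the
  block of \<open>n\<close> contribute to a partial sum.
\<close>

lemma blockwise_rearrangement:
  fixes d :: "nat \<Rightarrow> real"
  assumes zero: "\<And>m. sum d (block m) = 0" and bound: "\<And>j. \<bar>d j\<bar> \<le> M (block_index j)"
  obtains p where "bij p" "\<And>n. \<bar>\<Sum>k\<le>n. d (p k)\<bar> \<le> M (block_index n)"
proof -
  have "\<exists>xs. distinct xs \<and> set xs = block m \<and> (\<forall>i. \<bar>0 + sum_list (map d (take i xs))\<bar> \<le> M m)" for m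
  proof (rule bounded_partial_sums_ordering)
    show "\<bar>d x\<bar> \<le> M m" if "x \<in> block m" for x using bound[of x] that by (simp add: mem_block_iff)
    have "block_index (2 ^ m - 1) = m" using block_index_add[of 0 m] by simp
    thus "\<bar>0::real\<bar> \<le> M m" using bound[of "2 ^ m - 1"] by auto
  qed (simp_all add: zero)
  then obtain xs where xs: "\<And>m. distinct (xs m)" "\<And>m. set (xs m) = block m"
      "\<And>m i. \<bar>sum_list (map d (take i (xs m)))\<bar> \<le> M m"
    by simp metis
  have len: "length (xs m) = 2 ^ m" for m
    using distinct_card[OF xs(1)[of m]] by (simp only: xs(2) card_block)
  define p where "p j = xs (block_index j) ! (j - (2 ^ block_index j - 1))" for j
  have p_add: "p (2 ^ m - 1 + i) = xs m ! i" if "i < 2 ^ m" for m i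
    using block_index_add[OF that] by (simp add: p_def)
  have split: "\<exists>i<2 ^ block_index j. j = 2 ^ block_index j - 1 + i" for j
  proof -
    have "j \<in> block (block_index j)" by (simp only: mem_block_iff)
    thus ?thesis unfolding block_alt
      by (intro exI[of _ "j - (2 ^ block_index j - 1)"]) auto
  qed
  have index_p: "block_index (p j) = block_index j" for j
  proof -
    obtain i where i: "i < 2 ^ block_index j" "j = 2 ^ block_index j - 1 + i" using split by blast
    hence "p j = xs (block_index j) ! i" using p_add by metis
    also have "\<dots> \<in> block (block_index j)"
      using i len[of "block_index j"] xs(2)[of "block_index j"] nth_mem by metis
    finally show ?thesis by (simp only: mem_block_iff)
  qed
  have "inj p"
  proof (rule injI)
    fix j k assume eq: "p j = p k"
    hence m: "block_index k = block_index j" using index_p by metis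
    obtain i where i: "i < 2 ^ block_index j" "j = 2 ^ block_index j - 1 + i" using split by blast
    obtain i' where i': "i' < 2 ^ block_index j" "k = 2 ^ block_index j - 1 + i'"
      using split[of k] m by auto
    have "xs (block_index j) ! i = xs (block_index j) ! i'"
      using eq i i' p_add by metis
    hence "i = i'" using xs(1) len i(1) i'(1) by (simp add: nth_eq_iff_index_eq)
    thus "j = k" using i(2) i'(2) by simp
  qed
  moreover have "surj p"
    unfolding surj_def
  proof
    show "\<exists>x. y = p x" for y
    proof -
      have "y \<in> set (xs (block_index y))" using xs(2) mem_block_iff by blast
      then obtain i where "i < 2 ^ block_index y" "y = xs (block_index y) ! i"
        using len by (metis in_set_conv_nth)
      thus ?thesis using p_add by metis
    qed
  qed
  ultimately have "bij p" by (rule bijI)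
  moreover have "\<bar>\<Sum>k\<le>n. d (p k)\<bar> \<le> M (block_index n)" for n
  proof -
    have step: "(\<Sum>k<2 ^ m - 1 + i. d (p k)) = (\<Sum>k<2 ^ m - 1. d (p k)) + sum_list (map d (take i (xs m)))"
      if "i \<le> 2 ^ m" for m i
      using that
    proof (induction i)
      case (Suc i)
      have "(\<Sum>k<2 ^ m - 1 + Suc i. d (p k)) = (\<Sum>k<2 ^ m - 1 + i. d (p k)) + d (p (2 ^ m - 1 + i))"
        by (simp only: add_Suc_right sum.lessThan_Suc)
      also have "\<dots> = (\<Sum>k<2 ^ m - 1. d (p k)) + sum_list (map d (take i (xs m))) + d (xs m ! i)"
        using Suc p_add[of i m] by simp
      also have "\<dots> = (\<Sum>k<2 ^ m - 1. d (p k)) + sum_list (map d (take (Suc i) (xs m)))"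
        using Suc.prems len[of m] by (simp add: take_Suc_conv_app_nth)
      finally show ?case .
    qed simp
    have full: "sum_list (map d (take (2 ^ m) (xs m))) = 0" for m
      using zero[of m] sum_list_distinct_conv_sum_set[OF xs(1)[of m], of d]
      by (simp only: xs(2) take_all[OF eq_refl[OF len]])
    have start: "(\<Sum>k<2 ^ m - 1. d (p k)) = 0" for m
    proof (induction m)
      case (Suc m)
      have "2 ^ Suc m - 1 = 2 ^ m - 1 + (2::nat) ^ m" by simp
      thus ?case using step[of "2 ^ m" m] full Suc by simp
    qed simp
    obtain i where i: "i < 2 ^ block_index n" "n = 2 ^ block_index n - 1 + i" using split by blast
    have "(\<Sum>k\<le>n. d (p k)) = (\<Sum>k<2 ^ block_index n - 1 + Suc i. d (p k))"
      by (rule sum.cong) (use i(2) in auto)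
    also have "\<dots> = sum_list (map d (take (Suc i) (xs (block_index n))))"
      using step[of "Suc i" "block_index n"] start i(1) by simp
    finally show ?thesis using xs(3) by metis
  qed
  ultimately show ?thesis using that by blast
qed

definition block_average :: "(nat \<Rightarrow> real) \<Rightarrow> nat \<Rightarrow> real" where
  "block_average f j = sum f (block (block_index j)) / 2 ^ block_index j"

lemma sum_block_average: "(\<Sum>j\<in>block m. block_average f j) = sum f (block m)"
proof -
  have "(\<Sum>j\<in>block m. block_average f j) = (\<Sum>j\<in>block m. sum f (block m) / 2 ^ m)"
    by (intro sum.cong refl) (simp add: mem_block_iff block_average_def )
  also have "\<dots> = sum f (block m)" by (simp only: sum_constant card_block) simp
  finally show ?thesis .
qed

lemma sum_block_average_initial: "(\<Sum>j<2 ^ m - 1. block_average f j) = (\<Sum>j<2 ^ m - 1. f j)"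
proof (induction m)
  case (Suc m)
  have "{..<2 ^ Suc m - 1} = {..<2 ^ m - 1} \<union> block m" unfolding block_alt by auto
  moreover have "{..<2 ^ m - 1} \<inter> block m = {}" unfolding block_alt by auto
  ultimately show ?case using Suc by (simp add: sum.union_disjoint sum_block_average del: One_nat_def)
qed simp

context
  fixes f :: "nat \<Rightarrow> real" assumes f: "antimono f"
begin

lemma block_average_le: "block_average f j \<le> f (2 ^ block_index j - 1)"
proof -
  have "sum f (block (block_index j)) \<le> (\<Sum>k\<in>block (block_index j). f (2 ^ block_index j - 1))"
    by (intro sum_mono antimonoD[OF f]) (auto simp: block_def)
  thus ?thesis by (simp add: block_average_def field_simps card_block)
qed

lemma block_average_ge: "f (2 ^ (block_index j + 1) - 2) \<le> block_average f j"
proof -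
  have "(\<Sum>k\<in>block (block_index j). f (2 ^ (block_index j + 1) - 2)) \<le> sum f (block (block_index j))"
    by (intro sum_mono antimonoD[OF f]) (auto simp: block_def)
  thus ?thesis by (simp add: block_average_def field_simps card_block)
qed

text \<open>
  Averages over consecutive blocks are separated by the values of \<open>f\<close> at the end of the first block
  and at the beginning of the second.
\<close>

lemma antimono_block_average: "antimono (block_average f)"
proof
  fix j k :: nat assume jk: "j \<le> k"
  hence le: "block_index j \<le> block_index k"
    unfolding block_index_def by (intro floor_log_le_iff) simp
  show "block_average f k \<le> block_average f j"
  proof (cases "block_index j = block_index k")
    case False
    hence "2 ^ (block_index j + 1) \<le> (2::nat) ^ block_index k"
      using le by (intro power_increasing) auto
    hence "f (2 ^ block_index k - 1) \<le> f (2 ^ (block_index j + 1) - 2)"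
      by (intro antimonoD[OF f]) linarith
    thus ?thesis using block_average_le[of k] block_average_ge[of j] by linarith
  qed (simp add: block_average_def)
qed

lemma block_average_diff_le:
  assumes "\<And>j. f j \<ge> 0"
  shows "\<bar>block_average f j - f j\<bar> \<le> f (2 ^ block_index j - 1)"
proof -
  have "j \<in> block (block_index j)" by (simp only: mem_block_iff)
  hence "f j \<le> f (2 ^ block_index j - 1)" by (intro antimonoD[OF f]) (simp add: block_def)
  moreover have "block_average f j \<ge> 0"
    using assms by (simp add: block_average_def sum_nonneg)
  ultimately show ?thesis using block_average_le[of j] assms[of j] by linarith
qed

end

section \<open>Averages of a regularly varying function\<close>

locale decreasing_regular_variation =
  fixes g :: "real \<Rightarrow> real"
  assumes rv: "RV_minus_one g" and dec: "antimono_on {0..} g"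
begin

lemma g_pos: "t \<ge> 0 \<Longrightarrow> g t > 0"
  using rv by (simp add: RV_minus_one_def)

lemma g_mono: "0 \<le> s \<Longrightarrow> s \<le> t \<Longrightarrow> g t \<le> g s"
  using dec by (auto simp: monotone_on_def)

lemma g_ratio: "((\<lambda>t. g (2 * t) / g t) \<longlongrightarrow> 1 / 2) at_top"
proof -
  have "((\<lambda>t. g (2 * t) / g t) \<longlongrightarrow> inverse 2) at_top"
    using rv unfolding RV_minus_one_def by (meson zero_less_numeral)
  thus ?thesis by (simp add: inverse_eq_divide)
qed

abbreviation f :: "nat \<Rightarrow> real" where "f j \<equiv> g (real j)"

lemma antimono_f: "antimono f"
  by (rule antimonoI) (auto intro: g_mono)

lemma f_pos: "f j > 0" and f_nonneg: "f j \<ge> 0"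
  using g_pos[of "real j"] by auto

text \<open>
  A positive limit of \<open>f\<close> would force \<open>g(2t)/g(t)\<close> to tend to \<open>1\<close> rather than \<open>1/2\<close>.
\<close>

lemma f_null: "f \<longlonglongrightarrow> 0"
proof -
  obtain L where L: "f \<longlonglongrightarrow> L"
    using decseq_convergent[OF antimono_f, of 0] f_nonneg by blast
  have "L = 0"
  proof (rule ccontr)
    assume "L \<noteq> 0"
    have "strict_mono (\<lambda>j::nat. 2 * j)" by (simp add: strict_mono_def)
    from LIMSEQ_subseq_LIMSEQ[OF L this] have "(\<lambda>j. f (2 * j)) \<longlonglongrightarrow> L"
      by (simp add: o_def)
    hence "(\<lambda>j. f (2 * j) / f j) \<longlonglongrightarrow> L / L" using L \<open>L \<noteq> 0\<close> by (rule tendsto_divide)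
    moreover have "(\<lambda>j. f (2 * j) / f j) \<longlonglongrightarrow> 1 / 2"
      using filterlim_compose[OF g_ratio filterlim_real_sequentially] by simp
    ultimately have "L / L = 1 / 2" by (rule LIMSEQ_unique)
    thus False using \<open>L \<noteq> 0\<close> by simp
  qed
  thus ?thesis using L by simp
qed

text \<open>
  Regular variation gives the bound for large arguments; on the remaining compact interval, \<open>g\<close> lies
  between positive constants.
\<close>

lemma doubling: "\<exists>C. \<forall>t\<ge>0. g t \<le> C * g (2 * t)"
proof -
  have "eventually (\<lambda>t. g (2 * t) / g t > 1 / 3) at_top"
    by (rule order_tendstoD(1)[OF g_ratio]) simp
  then obtain t0 where t0: "\<And>t. t \<ge> t0 \<Longrightarrow> g (2 * t) / g t > 1 / 3"
    unfolding eventually_at_top_linorder by blast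
  define s where "s = max t0 0"
  define C where "C = max 3 (g 0 / g (2 * s))"
  have "g t \<le> C * g (2 * t)" if t: "t \<ge> 0" for t
  proof (cases "t \<ge> t0")
    case True
    hence "g t < 3 * g (2 * t)" using t0[OF True] g_pos[OF t] by (simp add: field_simps)
    also have "\<dots> \<le> C * g (2 * t)"
      using t g_pos[of "2 * t"] by (intro mult_right_mono) (auto simp: C_def)
    finally show ?thesis by simp
  next
    case False
    have "g t \<le> g 0" using t by (intro g_mono) auto
    also have "\<dots> = g 0 / g (2 * s) * g (2 * s)" using g_pos[of "2 * s"] by (simp add: s_def)
    also have "\<dots> \<le> C * g (2 * t)"
      using t False g_pos[of "2 * s"] g_pos[of 0]
      by (intro mult_mono g_mono) (auto simp: C_def s_def le_max_iff_disj)
    finally show ?thesis .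
  qed
  thus ?thesis by blast
qed

lemma block_start_le: "\<exists>C. \<forall>j. f (2 ^ block_index j - 1) \<le> C * f j"
proof -
  obtain C where C: "\<And>t. t \<ge> 0 \<Longrightarrow> g t \<le> C * g (2 * t)" using doubling by blast
  have "f (2 ^ block_index j - 1) \<le> C * f j" for j
  proof -
    have j: "j \<in> block (block_index j)" by (simp only: mem_block_iff)
    have "C * g 0 \<ge> g 0" using C[of 0] by simp
    hence C0: "C \<ge> 0" using g_pos[of 0] by (smt (verit) mult_nonneg_nonneg zero_le_mult_iff)
    have "f (2 ^ block_index j - 1) \<le> C * f (2 * (2 ^ block_index j - 1))"
      using C[of "real (2 ^ block_index j - 1)"] by simp
    also have "f (2 * (2 ^ block_index j - 1)) \<le> f j"
      using j by (intro antimonoD[OF antimono_f]) (simp add: block_def diff_mult_distrib2)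
    finally show ?thesis using C0 by (simp add: mult_left_mono)
  qed
  thus ?thesis by blast
qed

text \<open>
  The quantity \<open>\<beta>\<^sub>m = 2\<^sup>m f(2\<^sup>m - 1)\<close> bounds the error made by averaging over the \<open>m\<close>-th block. It is
  of smaller order than the sum \<open>S\<^sub>m\<close> of \<open>f\<close> over the preceding blocks: \<open>\<beta>\<^sub>m/\<beta>\<^sub>m\<^sub>+\<^sub>1\<close> is asymptotically at
  least \<open>1\<close>, and the \<open>m\<close>-th block contributes at least \<open>\<beta>\<^sub>m\<^sub>+\<^sub>1/2\<close>, so that every passage from \<open>m\<close> to
  \<open>m + 1\<close> raises an eventual lower bound on \<open>S\<^sub>m/\<beta>\<^sub>m\<close> by nearly \<open>1/2\<close>. Induction on \<open>K\<close> makes this precise.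
\<close>

lemma block_start_negligible:
  "eventually (\<lambda>m. real K / 4 * (2 ^ m * f (2 ^ m - 1)) \<le> (\<Sum>j<2 ^ m - 1. f j)) sequentially"
proof (induction K)
  case 0
  show ?case by (simp add: sum_nonneg f_nonneg)
next
  case (Suc K)
  \<comment> \<open>the loss \<open>K / 4 * e\<close> in the old bound stays below \<open>1 / 4\<close>, half of the gain\<close>
  define e where "e = 1 / (real K + 1)"
  have e1: "e \<le> 1" by (simp add: e_def)
  have "filterlim (\<lambda>m::nat. (2::nat) ^ m - 1) sequentially sequentially"
    by (rule filterlim_subseq) (simp add: strict_mono_Suc_iff diff_less_mono)
  hence "filterlim (\<lambda>m::nat. real (2 ^ m - 1)) at_top sequentially"
    by (rule filterlim_compose[OF filterlim_real_sequentially])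
  hence "(\<lambda>m. g (2 * real (2 ^ m - 1)) / f (2 ^ m - 1)) \<longlonglongrightarrow> 1 / 2"
    by (rule filterlim_compose[OF g_ratio])
  hence "(\<lambda>m. f (2 ^ m - 1) / g (2 * real (2 ^ m - 1))) \<longlonglongrightarrow> 2"
    using tendsto_inverse[of _ "1 / 2 :: real"] by (fastforce simp: inverse_eq_divide)
  moreover have "2 * (1 - e) < 2" by (simp add: e_def)
  ultimately have "eventually (\<lambda>m. f (2 ^ m - 1) / g (2 * real (2 ^ m - 1)) > 2 * (1 - e)) sequentially"
    by (rule order_tendstoD(1))
  with Suc have "eventually (\<lambda>m. real (Suc K) / 4 * (2 ^ Suc m * f (2 ^ Suc m - 1))
      \<le> (\<Sum>j<2 ^ Suc m - 1. f j)) sequentially"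
  proof eventually_elim
    case (elim m)
    define b where "b = 2 ^ Suc m * f (2 ^ Suc m - 1)"
    have b0: "b > 0" unfolding b_def by (intro mult_pos_pos f_pos) simp
    have le: "g (real (2 ^ Suc m - 1)) \<le> g (2 * real (2 ^ m - 1))"
      by (rule g_mono) (auto simp: of_nat_diff)
    have "2 * (1 - e) * g (real (2 ^ Suc m - 1)) \<le> 2 * (1 - e) * g (2 * real (2 ^ m - 1))"
      using le e1 by (intro mult_left_mono) auto
    also have "\<dots> \<le> f (2 ^ m - 1)"
      using elim(2) g_pos[of "2 * real (2 ^ m - 1)"] by (simp add: field_simps)
    finally have "2 ^ m * (2 * (1 - e) * f (2 ^ Suc m - 1)) \<le> 2 ^ m * f (2 ^ m - 1)"
      by (rule mult_left_mono) simp
    moreover have "2 ^ m * (2 * (1 - e) * f (2 ^ Suc m - 1)) = (1 - e) * b"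
      by (simp only: b_def power_Suc mult_ac)
    ultimately have "(1 - e) * b \<le> 2 ^ m * f (2 ^ m - 1)" by (simp only:)
    hence "real K / 4 * ((1 - e) * b) \<le> (\<Sum>j<2 ^ m - 1. f j)"
      using elim(1) mult_left_mono[of "(1 - e) * b" "2 ^ m * f (2 ^ m - 1)" "real K / 4"] by linarith
    moreover have "real K * e \<le> 1" by (simp add: e_def)
    hence "real K / 4 * b - b / 4 \<le> real K / 4 * ((1 - e) * b)"
      using mult_right_mono[of "real K * e" 1 b] b0 by (simp add: algebra_simps)
    moreover have "b / 2 \<le> sum f (block m)"
    proof -
      have "(\<Sum>j\<in>block m. f (2 ^ Suc m - 1)) \<le> sum f (block m)"
        by (intro sum_mono antimonoD[OF antimono_f]) (auto simp: block_alt)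
      thus ?thesis by (simp add: card_block b_def)
    qed
    moreover have "(\<Sum>j<2 ^ Suc m - 1. f j) = (\<Sum>j<2 ^ m - 1. f j) + sum f (block m)"
    proof -
      have "{..<2 ^ Suc m - 1} = {..<2 ^ m - 1} \<union> block m" unfolding block_alt by auto
      moreover have "{..<2 ^ m - 1} \<inter> block m = {}" unfolding block_alt by auto
      ultimately show ?thesis by (simp add: sum.union_disjoint del: One_nat_def)
    qed
    moreover have "real (Suc K) / 4 * b = real K / 4 * b - b / 4 + b / 2"
      by (simp add: field_simps)
    ultimately show ?case unfolding b_def[symmetric] by linarith
  qed
  thus ?case by (rule eventually_sequentially_Suc[THEN iffD1])
qed

text \<open>
  Averaging preserves the sum over complete blocks. Hence the partial sums differ only by the
  contribution of the last, incomplete block, which is negligible.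
\<close>

lemma block_average_partial_sums:
  "(\<lambda>n. (\<Sum>j<Suc n. block_average f j) / (\<Sum>j<Suc n. f j)) \<longlonglongrightarrow> 1"
proof (rule LIMSEQ_I)
  fix r :: real assume r: "r > 0"
  define F where "F n = (\<Sum>j<Suc n. f j)" for n
  have F0: "F n > 0" for n unfolding F_def by (intro sum_pos f_pos) auto
  obtain K where K: "real K > 4 / r" using reals_Archimedean2 by blast
  have "eventually (\<lambda>n. real K / 4 * (2 ^ block_index n * f (2 ^ block_index n - 1))
      \<le> (\<Sum>j<2 ^ block_index n - 1. f j)) sequentially"
    using eventually_compose_filterlim[OF block_start_negligible filterlim_block_index] .
  hence "eventually (\<lambda>n. norm ((\<Sum>j<Suc n. block_average f j) / F n - 1) < r) sequentially"
  proof eventually_elim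
    case (elim n)
    define m where "m = block_index n"
    define b where "b = 2 ^ m * f (2 ^ m - 1)"
    have b0: "b > 0" unfolding b_def by (intro mult_pos_pos f_pos) simp
    have n: "2 ^ m - 1 \<le> n" "n < 2 ^ Suc m - 1"
      using mem_block_iff[of n m] by (auto simp: m_def block_alt)
    have split: "{..<Suc n} = {..<2 ^ m - 1} \<union> {2 ^ m - 1..n}" using n(1) by auto
    have "(\<Sum>j<Suc n. block_average f j - f j) =
        (\<Sum>j<2 ^ m - 1. block_average f j - f j) + (\<Sum>j=2 ^ m - 1..n. block_average f j - f j)"
      unfolding split by (rule sum.union_disjoint) auto
    also have "(\<Sum>j<2 ^ m - 1. block_average f j - f j) = 0"
      unfolding sum_subtractf sum_block_average_initial by simp
    finally have "\<bar>\<Sum>j<Suc n. block_average f j - f j\<bar> = \<bar>\<Sum>j=2 ^ m - 1..n. block_average f j - f j\<bar>"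
      by simp
    also have "\<dots> \<le> (\<Sum>j=2 ^ m - 1..n. f (2 ^ m - 1))"
    proof (rule order_trans[OF sum_abs], rule sum_mono)
      fix j assume "j \<in> {2 ^ m - 1..n}"
      hence "j \<in> block m" using n(2) unfolding block_alt by auto
      hence "block_index j = m" by (simp only: mem_block_iff)
      thus "\<bar>block_average f j - f j\<bar> \<le> f (2 ^ m - 1)"
        using block_average_diff_le[OF antimono_f f_nonneg, of j] by simp
    qed
    also have "\<dots> = real (card {2 ^ m - 1..n}) * f (2 ^ m - 1)" by simp
    also have "\<dots> \<le> real (2 ^ m) * f (2 ^ m - 1)"
    proof (intro mult_right_mono f_nonneg of_nat_mono)
      have "card {2 ^ m - 1..n} \<le> card (block m)"
        using n(2) by (intro card_mono) (auto simp: block_alt)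
      thus "card {2 ^ m - 1..n} \<le> 2 ^ m" by (simp only: card_block)
    qed
    also have "\<dots> = b" by (simp add: b_def)
    finally have diff: "\<bar>(\<Sum>j<Suc n. block_average f j) - F n\<bar> \<le> b"
      by (simp only: sum_subtractf F_def)
    have "real K / 4 * b \<le> (\<Sum>j<2 ^ m - 1. f j)" using elim by (simp add: b_def m_def)
    also have "\<dots> \<le> F n"
      unfolding F_def using n(1) by (intro sum_mono2) (auto simp: f_nonneg)
    finally have "real K / 4 * b \<le> F n" .
    moreover have "1 / r * b < real K / 4 * b"
      using K b0 by (intro mult_strict_right_mono) (auto simp: field_simps)
    ultimately have "1 / r * b < F n" by linarith
    hence "b < r * F n" using r by (simp add: field_simps)
    hence "\<bar>(\<Sum>j<Suc n. block_average f j) - F n\<bar> < r * F n" using diff by linarith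
    moreover have "(\<Sum>j<Suc n. block_average f j) / F n - 1 = ((\<Sum>j<Suc n. block_average f j) - F n) / F n"
      using F0[of n] by (simp add: diff_divide_distrib)
    ultimately show ?case using F0[of n]
      by (simp add: abs_divide divide_less_eq del: sum.lessThan_Suc)
  qed
  thus "\<exists>no. \<forall>n\<ge>no. norm ((\<Sum>j<Suc n. block_average f j) / (\<Sum>j<Suc n. f j) - 1) < r"
    unfolding F_def eventually_sequentially .
qed

lemma g_integrable: "0 \<le> a \<Longrightarrow> g integrable_on {a..b}"
  using rv by (intro integrable_continuous_interval) (auto simp: RV_minus_one_def elim: continuous_on_subset)

text \<open>
  Comparison of the integral with its upper and lower Riemann sums of mesh \<open>1\<close>.
\<close>

lemma primitive_bounds:
  "(\<Sum>j<n. f j) - f 0 \<le> primitive g (real n) \<and> primitive g (real n) \<le> (\<Sum>j<n. f j)"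
proof -
  have step: "primitive g (real (Suc n)) = primitive g (real n) + integral {real n..real (Suc n)} g" for n
    unfolding primitive_def
    using Henstock_Kurzweil_Integration.integral_combine[where a = 0 and c = "real n" and b = "real (Suc n)" and f = g] g_integrable[of 0 "real (Suc n)"] by simp
  have "integral {real n..real (Suc n)} g \<le> integral {real n..real (Suc n)} (\<lambda>_. f n)" for n
    by (intro integral_le g_integrable) (auto intro: g_mono)
  hence up: "integral {real n..real (Suc n)} g \<le> f n" for n by simp
  have "integral {real n..real (Suc n)} (\<lambda>_. f (Suc n)) \<le> integral {real n..real (Suc n)} g" for n
    by (intro integral_le g_integrable) (auto intro: g_mono)
  hence lo: "f (Suc n) \<le> integral {real n..real (Suc n)} g" for n by simp
  have "(\<Sum>j<n. f j) + f n - f 0 \<le> primitive g (real n) \<and> primitive g (real n) \<le> (\<Sum>j<n. f j)"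
  proof (induction n)
    case 0
    show ?case by (simp add: primitive_def)
  next
    case (Suc n)
    thus ?case using step[of n] up[of n] lo[of n] by (simp only: sum.lessThan_Suc) linarith
  qed
  thus ?thesis using f_nonneg[of n] by linarith
qed

lemma block_average_partial_sums_primitive:
  assumes div: "filterlim (primitive g) at_top at_top"
  shows "(\<lambda>n. (\<Sum>j<Suc n. block_average f j) / primitive g (real (Suc n))) \<longlonglongrightarrow> 1"
proof -
  define G where "G n = primitive g (real (Suc n))" for n
  define F where "F n = (\<Sum>j<Suc n. f j)" for n
  have G: "filterlim G at_top sequentially"
    unfolding G_def
    by (rule filterlim_compose[OF div]) (rule filterlim_compose[OF filterlim_real_sequentially filterlim_Suc])
  have G0: "eventually (\<lambda>n. G n > 0) sequentially"
    using G unfolding filterlim_at_top_dense by blast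
  have "(\<lambda>n. f 0 / G n) \<longlonglongrightarrow> 0"
    by (rule tendsto_divide_0[OF tendsto_const filterlim_at_top_imp_at_infinity[OF G]])
  hence "(\<lambda>n. (F n - G n) / G n) \<longlonglongrightarrow> 0"
  proof (rule Lim_null_comparison[rotated])
    show "eventually (\<lambda>n. norm ((F n - G n) / G n) \<le> f 0 / G n) sequentially"
      using G0
    proof eventually_elim
      case (elim n)
      thus ?case using primitive_bounds[of "Suc n"]
        unfolding F_def[symmetric] G_def[symmetric] by (auto simp: abs_divide intro!: divide_right_mono)
    qed
  qed
  hence "(\<lambda>n. 1 + (F n - G n) / G n) \<longlonglongrightarrow> 1 + 0" by (intro tendsto_add tendsto_const)
  moreover have "eventually (\<lambda>n. 1 + (F n - G n) / G n = F n / G n) sequentially"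
    using G0 by eventually_elim (simp add: field_simps)
  ultimately have FG: "(\<lambda>n. F n / G n) \<longlonglongrightarrow> 1" using Lim_transform_eventually by fastforce
  have "F n > 0" for n unfolding F_def by (intro sum_pos f_pos) auto
  hence "F n \<noteq> 0" for n by (metis less_irrefl)
  hence eq: "A / F n * (F n / G n) = A / G n" for n A by simp
  have "(\<lambda>n. (\<Sum>j<Suc n. block_average f j) / F n) \<longlonglongrightarrow> 1"
    using block_average_partial_sums by (simp only: F_def)
  from tendsto_mult[OF this FG] show ?thesis unfolding eq by (simp add: G_def)
qed

text \<open>
  The average is the same at the first index \<open>s = 2\<^sup>m - 1\<close> and the last index \<open>2 s\<close> of a block, while
  \<open>f(2 s)/f(s)\<close> tends to \<open>1/2\<close>. A limit \<open>c\<close> of the ratios would satisfy \<open>c = c/2\<close>, yet \<open>c \<ge> 1\<close>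
  because the average is at least the value at the end of the block.
\<close>

lemma block_average_ratio_not_convergent: "\<not> convergent (\<lambda>j. inverse (f j) * block_average f j)"
proof
  assume "convergent (\<lambda>j. inverse (f j) * block_average f j)"
  then obtain c where c: "(\<lambda>j. inverse (f j) * block_average f j) \<longlonglongrightarrow> c"
    by (auto simp: convergent_def)
  define s e :: "nat \<Rightarrow> nat" where "s m = 2 ^ m - 1" and "e m = 2 * s m" for m
  have s: "strict_mono s" unfolding s_def by (simp add: strict_mono_Suc_iff diff_less_mono)
  hence e: "strict_mono e" by (simp add: e_def strict_mono_def)
  have e': "e m = 2 ^ (m + 1) - 2" for m by (simp add: e_def s_def)
  have le: "s m \<le> e m" by (simp add: e_def)
  have idx: "block_index (s m) = m" "block_index (e m) = m" for m
    using block_index_add[of 0 m] block_index_add[of "2 ^ m - 1" m]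
    by (simp_all add: s_def e_def mult_2)
  have avg: "block_average f (s m) = block_average f (e m)" for m
    by (simp add: block_average_def idx)
  have lims: "(\<lambda>m. inverse (f (s m)) * block_average f (s m)) \<longlonglongrightarrow> c"
    using LIMSEQ_subseq_LIMSEQ[OF c s] by (simp add: o_def)
  have lime: "(\<lambda>m. inverse (f (e m)) * block_average f (e m)) \<longlonglongrightarrow> c"
    using LIMSEQ_subseq_LIMSEQ[OF c e] by (simp add: o_def)
  have "filterlim (\<lambda>m. real (s m)) at_top sequentially"
    by (rule filterlim_compose[OF filterlim_real_sequentially filterlim_subseq[OF s]])
  hence "(\<lambda>m. f (e m) / f (s m)) \<longlonglongrightarrow> 1 / 2"
    using filterlim_compose[OF g_ratio] by (force simp: e_def)
  from tendsto_mult[OF lime this]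
  have "(\<lambda>m. inverse (f (s m)) * block_average f (s m)) \<longlonglongrightarrow> c * (1 / 2)"
    by (rule back_subst[of "\<lambda>h. h \<longlonglongrightarrow> c * (1 / 2)"])
       (use f_pos in \<open>auto simp: fun_eq_iff avg field_simps less_imp_neq[symmetric]\<close>)
  from LIMSEQ_unique[OF lims this] have "c = 0" by simp
  moreover have "c \<ge> 1"
  proof (rule LIMSEQ_le_const[OF lime], intro exI allI impI)
    fix m
    have "f (e m) \<le> block_average f (e m)"
      using block_average_ge[OF antimono_f, of "e m"] by (simp only: idx flip: e')
    thus "1 \<le> inverse (f (e m)) * block_average f (e m)"
      using f_pos[of "e m"] by (simp add: field_simps)
  qed
  ultimately show False by simp
qed

section \<open>Traces of diagonal operators\<close>

text \<open>
  If \<open>s\<^sub>n\<close> are the partial sums of the diagonal entries, \<open>S\<close> the forward shift with weights \<open>s\<^sub>n\<close> and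
  \<open>A\<close> the backward shift, then \<open>A S\<close> and \<open>S A\<close> are diagonal with entries \<open>s\<^sub>n\<close> and \<open>s\<^sub>n\<^sub>-\<^sub>1\<close>. So \<open>D\<close> is
  the single commutator \<open>[A, S]\<close>, and the bound on the partial sums puts \<open>S\<close> into the ideal.
\<close>

lemma trace_diagonal_eq_zero:
  fixes \<eta> :: "nat \<Rightarrow> 'a::complex_hilbert"
  assumes \<phi>: "trace_on g \<phi>" and \<eta>: "orthonormal_basis \<eta>"
    and s: "\<And>n. \<bar>\<Sum>k\<le>n. d k\<bar> \<le> C * f n"
    and D: "bounded_clinear D" "\<And>n. D (\<eta> n) = complex_of_real (d n) *\<^sub>C \<eta> n"
  shows "\<phi> D = 0"
proof -
  have o: "orthonormal \<eta>" "orthonormal (\<lambda>n. \<eta> (Suc n))"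
    using \<eta> by (auto intro: orthonormal_basis_imp_orthonormal orthonormal_reindex)
  define S where "S = transfer_operator \<eta> (\<lambda>n. \<eta> (Suc n)) (\<lambda>n. complex_of_real (\<Sum>k\<le>n. d k))"
  define A where "A = transfer_operator (\<lambda>n. \<eta> (Suc n)) \<eta> (\<lambda>n. 1)"
  have bound: "cmod (complex_of_real (\<Sum>k\<le>n. d k)) \<le> C * f n" for n
    unfolding norm_of_real by (rule s)
  have S: "S \<in> weak_lorentz g"
    unfolding S_def by (rule transfer_operator_in_weak_lorentz[OF \<eta> o(2) bound antimono_f f_null])
  have "\<bar>C\<bar> * f n \<le> \<bar>C\<bar> * f 0" for n
    by (intro mult_left_mono antimonoD[OF antimono_f]) auto
  hence M: "cmod (complex_of_real (\<Sum>k\<le>n. d k)) \<le> \<bar>C\<bar> * f 0" for n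
    using bound[of n] mult_right_mono[OF abs_ge_self f_nonneg, of C n] order_trans by meson
  have bS: "bounded_clinear S" unfolding S_def by (rule bounded_clinear_transfer_operator[OF o M])
  have A1: "\<And>n. cmod (1::complex) \<le> 1" by simp
  have bA: "bounded_clinear A"
    unfolding A_def by (rule bounded_clinear_transfer_operator[OF o(2,1) A1])
  have S_apply: "S (\<eta> n) = complex_of_real (\<Sum>k\<le>n. d k) *\<^sub>C \<eta> (Suc n)" for n
    unfolding S_def by (rule transfer_operator_apply[OF o M])
  have A_Suc: "A (\<eta> (Suc n)) = \<eta> n" for n
    using transfer_operator_apply[OF o(2,1) A1, of n] by (simp add: A_def)
  have A_0: "A (\<eta> 0) = 0"
    unfolding A_def by (rule transfer_operator_orthogonal) (simp add: orthonormalD[OF o(1)])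
  have S0: "S 0 = 0" using bounded_clinearD[OF bS] by (rule linear_simps)
  have "(\<lambda>x. A (S x) - S (A x)) = D"
  proof (rule bounded_clinear_eq_on_basis[OF \<eta> _ D(1)])
    show "bounded_clinear (\<lambda>x. A (S x) - S (A x))"
      by (rule bounded_clinear_diff[OF bounded_clinear_compose[OF bA bS] bounded_clinear_compose[OF bS bA]])
    fix n
    have AS: "A (S (\<eta> n)) = complex_of_real (\<Sum>k\<le>n. d k) *\<^sub>C \<eta> n"
      by (simp only: S_apply bounded_clinear_scaleC[OF bA] A_Suc)
    show "A (S (\<eta> n)) - S (A (\<eta> n)) = D (\<eta> n)"
    proof (cases n)
      case 0
      thus ?thesis using AS by (simp add: A_0 S0 D(2))
    next
      case (Suc m)
      hence SA: "S (A (\<eta> n)) = complex_of_real (\<Sum>k\<le>m. d k) *\<^sub>C \<eta> n" by (simp only: A_Suc S_apply)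
      have "(\<Sum>k\<le>n. d k) - (\<Sum>k\<le>m. d k) = d n" by (simp add: Suc)
      thus ?thesis
        unfolding AS SA D(2) by (simp only: flip: complex_vector.scale_left_diff_distrib of_real_diff)
    qed
  qed
  moreover have "\<phi> (\<lambda>x. A (S x) - S (A x)) = 0"
    using \<phi> S bA by (auto simp: trace_on_def)
  ultimately show ?thesis by simp
qed

lemma abs_block_average_le: "\<exists>C. \<forall>j. \<bar>block_average f j\<bar> \<le> C * f j"
proof -
  obtain C where C: "\<And>j. f (2 ^ block_index j - 1) \<le> C * f j" using block_start_le by blast
  have "block_average f j \<ge> 0" for j by (simp add: block_average_def sum_nonneg f_nonneg)
  hence "\<bar>block_average f j\<bar> \<le> C * f j" for j
    using block_average_le[OF antimono_f, of j] C[of j] by simp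
  thus ?thesis by blast
qed

text \<open>
  The difference of the averaged and the original diagonal operator has sum zero on each block.
  After a permutation of the basis within the blocks its partial sums are \<open>O(f)\<close>, so that every trace
  annihilates it. In the given order they may be as large as the block, whence the permutation.
\<close>

lemma normalized_trace_block_average:
  fixes \<xi> :: "nat \<Rightarrow> 'a::complex_hilbert"
  assumes \<phi>: "normalized_trace_on g \<phi>" and \<xi>: "orthonormal_basis \<xi>"
  shows "\<phi> (transfer_operator \<xi> \<xi> (\<lambda>j. complex_of_real (block_average f j))) = 1"
proof -
  define d where "d j = block_average f j - f j" for j
  have o: "orthonormal \<xi>" using \<xi> by (rule orthonormal_basis_imp_orthonormal)
  let ?op = "\<lambda>a. transfer_operator \<xi> \<xi> (\<lambda>j. complex_of_real (a j))"
  have op: "?op a \<in> weak_lorentz g" "bounded_clinear (?op a)"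
      "?op a (\<xi> j) = complex_of_real (a j) *\<^sub>C \<xi> j"
    if a: "\<And>j. \<bar>a j\<bar> \<le> C * f j" for a C j
  proof -
    have a': "cmod (complex_of_real (a j)) \<le> C * f j" for j unfolding norm_of_real by (rule a)
    show "?op a \<in> weak_lorentz g"
      by (rule transfer_operator_in_weak_lorentz[OF \<xi> o a' antimono_f f_null])
    have "cmod (complex_of_real (a j)) \<le> \<bar>C\<bar> * f 0" for j
    proof -
      have "C * f j \<le> \<bar>C\<bar> * f 0"
        by (intro mult_mono antimonoD[OF antimono_f]) (auto intro: f_nonneg)
      thus ?thesis using a'[of j] by linarith
    qed
    note M = this
    show "bounded_clinear (?op a)" by (rule bounded_clinear_transfer_operator[OF o o M])
    show "?op a (\<xi> j) = complex_of_real (a j) *\<^sub>C \<xi> j" by (rule transfer_operator_apply[OF o o M])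
  qed
  obtain C where C: "\<And>j. f (2 ^ block_index j - 1) \<le> C * f j" using block_start_le by blast
  obtain C' where C': "\<And>j. \<bar>block_average f j\<bar> \<le> C' * f j" using abs_block_average_le by blast
  have d_le: "\<bar>d j\<bar> \<le> f (2 ^ block_index j - 1)" for j
    unfolding d_def by (rule block_average_diff_le[OF antimono_f f_nonneg])
  have d_C: "\<bar>d j\<bar> \<le> C * f j" for j using d_le[of j] C[of j] by linarith
  have f_1: "\<bar>f j\<bar> \<le> 1 * f j" for j using f_nonneg[of j] by simp
  have tr: "trace_on g \<phi>" using \<phi> by (simp add: normalized_trace_on_def)
  have "sum d (block m) = 0" for m
    unfolding d_def sum_subtractf sum_block_average by simp
  then obtain p where p: "bij p" "\<And>n. \<bar>\<Sum>k\<le>n. d (p k)\<bar> \<le> f (2 ^ block_index n - 1)"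
    using blockwise_rearrangement[of d "\<lambda>m. f (2 ^ m - 1)"] d_le by blast
  have "\<phi> (?op d) = 0"
  proof (rule trace_diagonal_eq_zero[OF tr orthonormal_basis_reindex[OF \<xi> p(1)]])
    show "\<bar>\<Sum>k\<le>n. d (p k)\<bar> \<le> C * f n" for n using p(2)[of n] C[of n] by linarith
  qed (use op[OF d_C] in auto)
  moreover have "\<phi> (?op f) = 1"
    using \<phi> \<xi> op(2,3)[OF f_1] unfolding normalized_trace_on_def by blast
  moreover have "?op (block_average f) = (\<lambda>x. ?op f x + ?op d x)"
  proof (rule bounded_clinear_eq_on_basis[OF \<xi> op(2)[OF C'] bounded_clinear_add[OF op(2)[OF f_1] op(2)[OF d_C]]])
    show "?op (block_average f) (\<xi> j) = ?op f (\<xi> j) + ?op d (\<xi> j)" for j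
      unfolding op(3)[OF C'] op(3)[OF f_1] op(3)[OF d_C]
      by (simp add: d_def flip: complex_vector.scale_left_distrib)
  qed
  moreover have "\<phi> (\<lambda>x. ?op f x + ?op d x) = \<phi> (?op f) + \<phi> (?op d)"
    using tr op(1)[OF f_1] op(1)[OF d_C] unfolding trace_on_def by blast
  ultimately show ?thesis by simp
qed

end

theorem proposition4p22:
  fixes g :: "real \<Rightarrow> real"
    and \<xi> :: "nat \<Rightarrow> 'a::complex_hilbert"
    and lam :: "nat \<Rightarrow> real"
    and T :: "'a \<Rightarrow> 'a"
  assumes "RV_minus_one g"
    and "antimono_on {0..} g"
    and "filterlim (primitive g) at_top at_top"
    and "orthonormal_basis \<xi>"
    and "\<And>m j. 2 ^ m - 1 \<le> j \<Longrightarrow> j \<le> 2 ^ (m + 1) - 2 \<Longrightarrow>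
           lam j = (\<Sum>k = 2 ^ m - 1..2 ^ (m + 1) - 2. g (real k)) / 2 ^ m"
    and "bounded_clinear T"
    and "\<And>j. T (\<xi> j) = complex_of_real (lam j) *\<^sub>C \<xi> j"
  shows "positive_operator T \<and> compact_operator T \<and> T \<in> weak_lorentz g \<and>
         hypermeasurable g T \<and> dixmier_measurable g T \<and> nc_integral g T = 1 \<and>
         \<not> spectrally_measurable g T"
proof -
  interpret decreasing_regular_variation g by (rule decreasing_regular_variation.intro) fact+
  note \<xi> = \<open>orthonormal_basis \<xi>\<close>
  have o: "orthonormal \<xi>" using \<xi> by (rule orthonormal_basis_imp_orthonormal)
  have "lam j = block_average f j" for j
    using assms(5)[of "block_index j" j] mem_block_iff[of j "block_index j"]
    by (simp add: block_average_def block_def)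
  hence lam: "lam = block_average f" by blast
  obtain C where C: "\<And>j. \<bar>lam j\<bar> \<le> C * f j" using abs_block_average_le lam by blast
  hence cC: "cmod (complex_of_real (lam j)) \<le> C * f j" for j unfolding norm_of_real by blast
  have lam0: "lam j \<ge> 0" for j by (simp add: lam block_average_def sum_nonneg f_nonneg)
  have mono: "antimono lam" unfolding lam by (rule antimono_block_average[OF antimono_f])
  have M: "cmod (complex_of_real (lam j)) \<le> lam 0" for j
    using antimonoD[OF mono, of 0 j] lam0[of j] by simp
  have null: "lam \<longlonglongrightarrow> 0"
    by (rule Lim_null_comparison[OF _ tendsto_mult_right_zero[OF f_null, of C]]) (simp add: C)
  hence null': "(\<lambda>j. complex_of_real (lam j)) \<longlonglongrightarrow> 0"
    using tendsto_of_real[OF null, where 'a = complex] by simp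
  have T: "T = transfer_operator \<xi> \<xi> (\<lambda>j. complex_of_real (lam j))"
    by (rule bounded_clinear_eq_on_basis[OF \<xi> assms(6) bounded_clinear_transfer_operator[OF o o M]])
       (simp only: assms(7) transfer_operator_apply[OF o o M])
  have pos: "positive_operator T"
    unfolding T by (rule positive_transfer_operator[OF o M]) (simp add: lam0)
  have cpt: "compact_operator T"
    unfolding T by (rule compact_operator_transfer_operator[OF o o null'])
  have wl: "T \<in> weak_lorentz g"
    unfolding T by (rule transfer_operator_in_weak_lorentz[OF \<xi> o cC antimono_f f_null])
  have hyper: "hypermeasurable g T"
    using wl normalized_trace_block_average[OF _ \<xi>] unfolding hypermeasurable_def T lam by blast
  have eigen: "eigenvalues T = (\<lambda>j. complex_of_real (lam j))"
    unfolding T by (rule eigenvalues_decreasing_diagonal[OF \<xi> mono null])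
  have dix: "dixmier_trace g \<omega> T = 1" if "extended_limit \<omega>" for \<omega>
  proof -
    have "(\<lambda>n. complex_of_real ((\<Sum>j<Suc n. lam j) / primitive g (real (Suc n)))) \<longlonglongrightarrow> complex_of_real 1"
      unfolding lam by (intro tendsto_of_real block_average_partial_sums_primitive assms(3))
    hence "(\<lambda>n. (\<Sum>j<Suc n. eigenvalues T j) / complex_of_real (primitive g (real (Suc n)))) \<longlonglongrightarrow> 1"
      by (simp only: eigen of_real_divide of_real_sum of_real_1)
    thus ?thesis using that unfolding dixmier_trace_def extended_limit_def by blast
  qed
  hence dm: "dixmier_measurable g T" using wl unfolding dixmier_measurable_def by blast
  have nc: "nc_integral g T = 1"
    unfolding nc_integral_def
  proof (rule the_equality)
    show "\<forall>\<omega>. extended_limit \<omega> \<longrightarrow> dixmier_trace g \<omega> T = 1" using dix by blast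
    show "c = 1" if "\<forall>\<omega>. extended_limit \<omega> \<longrightarrow> dixmier_trace g \<omega> T = c" for c
      using that dix extended_limit_exists by metis
  qed
  have "abs_operator T = T"
    unfolding T abs_transfer_operator[OF \<xi> o M] by (simp add: lam0)
  hence "pos_part T = T"
    unfolding pos_part_def by (simp add: scaleC_add_right flip: scaleC_add_left complex_vector.scale_right_distrib)
  hence "\<not> spectrally_measurable g T"
    using block_average_ratio_not_convergent unfolding spectrally_measurable_def
    by (simp add: eigen lam)
  thus ?thesis using pos cpt wl hyper dm nc by blast
qed

end
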